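(* Let $w\in\mathbb Z^{2n}\setminus\{0\}$ be a weight vector with $w_i+w_{n+i}\ge0$ ($1\le i\le n$), let $\mathbf m,\mathbf n\in\mathbb Z^r$, and let $\prec$ be a monomial order on $L\times\{1,\dots,r\}$, $L=\mathbb N^{2n}$, adapted to $F_w[\mathbf m]$. Let $N\subset A_n^r$ be a finitely generated left $A_n$-submodule, let $h[\mathbf n](N)\subset(A_n^{(h)})^r$ be the left $A_n^{(h)}$-submodule generated by the $h[\mathbf n]$-homogenizations of a given finite set of generators of $N$, and let $\{P_1,\dots,P_s\}$ be a Gröbner basis of $h[\mathbf n](N)$ with respect to $\prec_{h[\mathbf n]}$ consisting of nonzero $h[\mathbf n]$-homogeneous elements. Put $\Lambda=\{(i,j)\mid1\le i<j\le s,\ \mathrm{lp}(P_i)=\mathrm{lp}(P_j)\}$. For $(i,j)\in\Lambda$ let $S_{ij},S_{ji}\in A_n^{(h)}$ be monomials (with coefficients) such that $$\mathrm{lexp}(S_{ji}P_i)=\mathrm{lexp}(S_{ij}P_j)=\mathrm{lexp}(P_i)\vee\mathrm{lexp}(P_j),\qquad\mathrm{lcoef}(S_{ji}P_i)=\mathrm{lcoef}(S_{ij}P_j),$$ and let $U_{ijk}\in A_n^{(h)}$ be homogeneous elements (as given by the Buchberger algorithm), each $U_{ijk}P_k$ being zero or $h[\mathbf n]$-homogeneous of the same degree as $S_{ji}P_i$, such that $$S_{ji}P_i-S_{ij}P_j=\sum_{k=1}^sU_{ijk}P_k$$ and, for each $k$, either $U_{ijk}=0$ or $\mathrm{lexp}(U_{ijk}P_k)\prec_{h[\mathbf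 n]}\mathrm{lexp}(P_i)\vee\mathrm{lexp}(P_j)$. Let $\prec'$ be the order on $\mathbb N\times L\times\{1,\dots,s\}$ defined by: $(\alpha,\mu)\prec'(\beta,\nu)$ if and only if $\mathrm{lexp}(P_\mu)+\alpha\prec_{h[\mathbf n]}\mathrm{lexp}(P_\nu)+\beta$, or else $\mathrm{lexp}(P_\mu)+\alpha=\mathrm{lexp}(P_\nu)+\beta$ and $\mu>\nu$ ($\alpha,\beta\in\mathbb N\times L$). Put $$\mathbf m'=(\mathrm{ord}_w[\mathbf m](\rho(P_1)),\dots,\mathrm{ord}_w[\mathbf m](\rho(P_s))),\qquad\mathbf n'=(\deg[\mathbf n](P_1),\dots,\deg[\mathbf n](P_s)).$$ Then $\prec'$ is a well-order adapted to the $F_w[\mathbf m']$-filtration, and: (1) For $(i,j)\in\Lambda$, the element $$V_{ij}=(0,\dots,\overset{(i)}{S_{ji}},\dots,\overset{(j)}{-S_{ij}},\dots,0)-(U_{ij1},\dots,U_{ijs})\in(A_n^{(h)})^s$$ is $h[\mathbf n']$-homogeneous, and $\{V_{ij}\mid(i,j)\in\Lambda\}$ is a Gröbner basis with respect to $\prec'$ of $$\mathrm{Syz}(P_1,\dots,P_s)=\{(U_1,\dots,U_s)\in(A_n^{(h)})^s\mid U_1P_1+\dots+U_sP_s=0\}.$$ (2) Put $\mathrm{Syz}(\rho(P_1),\dots,\rho(P_s))=\{(U_1,\dots,U_s)\in A_n^s\mid U_1\rho(P_1)+\dots+U_s\rho(P_s)=0\}$. For any $\nu\in\mathbb Z$ and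 any $P\in\mathrm{Syz}(\rho(P_1),\dots,\rho(P_s))\cap F_w^\nu[\mathbf m'](A_n^s)$ there exist $Q_{ij}\in A_n$ such that $P=\sum_{(i,j)\in\Lambda}Q_{ij}\rho(V_{ij})$ and $Q_{ij}\rho(V_{ij})\in F_w^\nu[\mathbf m'](A_n^s)$ for all $(i,j)\in\Lambda$.
   Context: $K$ is a field of characteristic zero, $A_n=K[x]\langle\partial\rangle$ the Weyl algebra in $x=(x_1,\dots,x_n)$, $\partial=(\partial_1,\dots,\partial_n)$. The homogenized Weyl algebra $A_n^{(h)}$ is the $K$-algebra generated by $h,x,\partial$ with relations $x_ix_j=x_jx_i$, $\partial_i\partial_j=\partial_j\partial_i$, $x_i\partial_j-\partial_jx_i=-\delta_{ij}h^2$, $h$ central. Elements are uniquely finite sums $\sum a_{\lambda\alpha\beta}h^\lambda x^\alpha\partial^\beta$. $\rho:A_n^{(h)}\to A_n$ (and on tuples) is the ring homomorphism $h\mapsto1$. Total degree $\deg$ is the maximum of $\lambda+|\alpha|+|\beta|$; $\deg[\mathbf n](P)=\max_i(\deg(P_i)+n_i)$ for $P\in(A_n^{(h)})^r$. Filtration: $F_w^\nu(A_n)$ is the set of $\sum a_{\alpha\beta}x^\alpha\partial^\beta$ with $\sum_iw_i\alpha_i+\sum_iw_{n+i}\beta_i\le\nu$ in every term; $F_w^k[\mathbf m](A_n^r)=\bigoplus_iF_w^{k-m_i}(A_n)e_i$; $\mathrm{ord}_w[\mathbf m](P)=\min\{k:P\in F_w^k[\mathbf m](A_n^r)\}$ for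 $P\neq0$. $h[\mathbf n]$-homogeneous: $P=\sum a_{\lambda\alpha\beta i}h^\lambda x^\alpha\partial^\beta e_i$ with all $\lambda+|\alpha|+|\beta|+n_i$ equal (the degree) over nonzero terms; homogeneous in $A_n^{(h)}$ means this with shift $0$. The $h[\mathbf n]$-homogenization of $P=\sum a_{\alpha\beta i}x^\alpha\partial^\beta e_i\in A_n^r$ is $\sum a_{\alpha\beta i}h^{k-|\alpha|-|\beta|-n_i}x^\alpha\partial^\beta e_i$ with $k=\max\{|\alpha|+|\beta|+n_i:a_{\alpha\beta i}\ne0\}$. Orders: a monomial order $\prec$ on $L\times\{1,\dots,r\}$ is a total order such that $(\alpha,i)\prec(\beta,j)$ implies $(\alpha+\gamma,i)\prec(\beta+\gamma,j)$. It is adapted to $F_w[\mathbf m]$ if $\langle w,\alpha\rangle+m_i<\langle w,\beta\rangle+m_j$ implies $(\alpha,i)\prec(\beta,j)$ and the leading exponent of $e_i$ is $\prec$ that of $x_j\partial_je_i$ for all $i,j$. On $\mathbb N\times L\times\{1,\dots,r\}$: $(\lambda,\alpha,i)\prec_{h[\mathbf n]}(\mu,\beta,j)$ iff $\lambda+|\alpha|+n_i<\mu+|\beta|+n_j$, or these are equal and $(\alpha,i)\prec(\beta,j)$. "$\prec'$ is adapted to $F_w[\mathbf m']$" means the same two conditions for pairs of elements $(\lambda,\alpha,\mu)$, $(\lambda',\beta,\nu)$ with the same value of $\lambda+|\alpha|+n'_\mu$: smaller $\langle w,\alpha\rangle+m'_\mu$ implies smaller in $\prec'$, and the exponent of $h^2e_\mu$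 is $\prec'$ that of $x_j\partial_je_\mu$. For nonzero $P\in(A_n^{(h)})^r$, $\mathrm{lexp}(P)=(\lambda_0,\alpha_0,\beta_0,i_0)$ is the $\prec_{h[\mathbf n]}$-maximal exponent occurring, $\mathrm{lp}(P)=i_0$, and $\mathrm{lcoef}(P)$ is its coefficient. For exponents with equal position, $(\alpha,i)\vee(\beta,i)$ is the componentwise maximum with position $i$; for an exponent $(\alpha,i)$ and $\gamma\in\mathbb N\times L$, $(\alpha,i)+\gamma=(\alpha+\gamma,i)$. A finite subset $G$ of a left submodule $N'$ is a Gröbner basis with respect to an order if every leading exponent of a nonzero element of $N'$ lies in $\bigcup_{P\in G}(\mathrm{lexp}(P)+\mathbb N\times L)$ (leading exponents with respect to that order). *)

theory Defs
  imports
    Complex_Main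
    "HOL-Library.FuncSet"
    "HOL-Library.Poly_Mapping"
    "HOL-Library.Function_Algebras"
    "HOL-Library.Product_Plus"
begin

section \<open>The Weyl algebra and the homogenized Weyl algebra\<close>

text \<open>
  The number of variables is the cardinality of the finite type \<open>'n\<close>.  An exponent in
  \<open>L = \<nat>\<^sup>2\<^sup>n\<close> is a function on \<open>'n + 'n\<close>: \<open>Inl i\<close> is the slot of \<open>x\<^sub>i\<close>
  and \<open>Inr i\<close> the slot of \<open>\<partial>\<^sub>i\<close>.  An exponent of the homogenized algebra is a
  pair whose first component is the exponent of \<open>h\<close>.
\<close>

type_synonym 'n expo = "'n + 'n \<Rightarrow> nat"
type_synonym 'n hexpo = "nat \<times> 'n expo"

definition unit_expo :: "'n + 'n \<Rightarrow> 'n expo"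
  where "unit_expo v = (\<lambda>u. if u = v then 1 else 0)"

definition tdeg :: "'n::finite expo \<Rightarrow> nat"
  where "tdeg \<alpha> = (\<Sum>v\<in>UNIV. \<alpha> v)"

definition hdeg :: "'n::finite hexpo \<Rightarrow> nat"
  where "hdeg e = fst e + tdeg (snd e)"

text \<open>
  Both algebras are modelled on their bases of normally ordered monomials, i.e. as finitely
  supported coefficient functions.  The product of \<open>h\<^sup>\<lambda> x\<^sup>a \<partial>\<^sup>b\<close> and
  \<open>h\<^sup>\<mu> x\<^sup>c \<partial>\<^sup>d\<close> is given by the Leibniz rule, as the sum over all multi-indices
  \<open>\<kappa> \<le> b, c\<close> of
    \<open>(\<Prod>i. \<kappa>\<^sub>i! (b\<^sub>i choose \<kappa>\<^sub>i) (c\<^sub>i choose \<kappa>\<^sub>i))\<close> times the monomial with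
  \<open>h\<close>-exponent \<open>\<lambda> + \<mu> + 2|\<kappa>|\<close>, \<open>x\<close>-exponent \<open>a + c - \<kappa>\<close> and \<open>\<partial>\<close>-exponent
  \<open>b + d - \<kappa>\<close>; in the Weyl algebra the powers of \<open>h\<close> are absent.  These are the algebras
  presented by the usual generators and relations: besides the ring laws, the relations
  (\<open>hX_hX\<close>, \<open>hD_hD\<close>, \<open>hX_hD\<close>, \<open>hH_central\<close>, \<open>hscalar_central\<close>) and the fact that the basis
  monomials are the ordered products of the generators (\<open>hmon_normal_form\<close>) are proved below,
  together with the analogues for the Weyl algebra.
\<close>

definition contractions :: "'n expo \<Rightarrow> 'n expo \<Rightarrow> ('n \<Rightarrow> nat) set"
  where "contractions \<alpha> \<beta> = {\<kappa>. \<forall>i. \<kappa> i \<le> \<alpha> (Inr i) \<and> \<kappa> i \<le> \<beta> (Inl i)}"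

definition contr_coeff :: "'n::finite expo \<Rightarrow> 'n expo \<Rightarrow> ('n \<Rightarrow> nat) \<Rightarrow> nat"
  where "contr_coeff \<alpha> \<beta> \<kappa> =
    (\<Prod>i\<in>UNIV. fact (\<kappa> i) * (\<alpha> (Inr i) choose \<kappa> i) * (\<beta> (Inl i) choose \<kappa> i))"

definition contr_expo :: "'n expo \<Rightarrow> 'n expo \<Rightarrow> ('n \<Rightarrow> nat) \<Rightarrow> 'n expo"
  where "contr_expo \<alpha> \<beta> \<kappa> = (\<lambda>v. \<alpha> v + \<beta> v - case_sum \<kappa> \<kappa> v)"

definition mono_prod ::
    "'n::finite expo \<Rightarrow> 'n expo \<Rightarrow> 'k \<Rightarrow> 'n expo \<Rightarrow>\<^sub>0 'k::comm_ring_1"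
  where "mono_prod \<alpha> \<beta> c =
    (\<Sum>\<kappa>\<in>contractions \<alpha> \<beta>.
       Poly_Mapping.single (contr_expo \<alpha> \<beta> \<kappa>) (c * of_nat (contr_coeff \<alpha> \<beta> \<kappa>)))"

definition hmono_prod ::
    "'n::finite hexpo \<Rightarrow> 'n hexpo \<Rightarrow> 'k \<Rightarrow> 'n hexpo \<Rightarrow>\<^sub>0 'k::comm_ring_1"
  where "hmono_prod a b c =
    (\<Sum>\<kappa>\<in>contractions (snd a) (snd b).
       Poly_Mapping.single
         (fst a + fst b + 2 * (\<Sum>i\<in>UNIV. \<kappa> i), contr_expo (snd a) (snd b) \<kappa>)
         (c * of_nat (contr_coeff (snd a) (snd b) \<kappa>)))"

definition bilin_ext ::
    "('a \<Rightarrow> 'a \<Rightarrow> 'k \<Rightarrow> 'a \<Rightarrow>\<^sub>0 'k) \<Rightarrow> ('a \<Rightarrow>\<^sub>0 'k) \<Rightarrow> ('a \<Rightarrow>\<^sub>0 'k) \<Rightarrow> ('a \<Rightarrow>\<^sub>0 'k::comm_ring_1)"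
  where "bilin_ext f P Q =
    (\<Sum>a\<in>Poly_Mapping.keys P. \<Sum>b\<in>Poly_Mapping.keys Q.
       f a b (Poly_Mapping.lookup P a * Poly_Mapping.lookup Q b))"

subsection \<open>Associativity of the multiplication\<close>

lemma pm_expand:
  "P = (\<Sum>a\<in>Poly_Mapping.keys P. Poly_Mapping.single a (Poly_Mapping.lookup P a))"
proof (rule poly_mapping_eqI)
  fix k
  have "Poly_Mapping.lookup (\<Sum>a\<in>Poly_Mapping.keys P.
      Poly_Mapping.single a (Poly_Mapping.lookup P a)) k
    = (\<Sum>a\<in>Poly_Mapping.keys P. if a = k then Poly_Mapping.lookup P a else 0)"
    by (simp add: lookup_sum lookup_single when_def)
  also have "\<dots> = Poly_Mapping.lookup P k"
    by (simp add: sum.delta in_keys_iff)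
  finally show "Poly_Mapping.lookup P k = Poly_Mapping.lookup (\<Sum>a\<in>Poly_Mapping.keys P.
      Poly_Mapping.single a (Poly_Mapping.lookup P a)) k" by simp
qed

lemma pm_induct [case_names zero add single]:
  assumes "Q 0" and "\<And>p q. Q p \<Longrightarrow> Q q \<Longrightarrow> Q (p + q)"
    and "\<And>a c. Q (Poly_Mapping.single a c)"
  shows "Q (P :: 'a \<Rightarrow>\<^sub>0 'k::comm_ring_1)"
proof -
  have "finite S \<Longrightarrow> Q (\<Sum>a\<in>S. Poly_Mapping.single a (g a))" for S and g :: "'a \<Rightarrow> 'k"
    by (induction S rule: finite_induct) (auto intro: assms)
  then have "Q (\<Sum>a\<in>Poly_Mapping.keys P. Poly_Mapping.single a (Poly_Mapping.lookup P a))"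
    by simp
  then show ?thesis using pm_expand[of P] by metis
qed

locale pm_additive =
  fixes f :: "'a \<Rightarrow> 'a \<Rightarrow> 'k \<Rightarrow> 'a \<Rightarrow>\<^sub>0 'k::comm_ring_1"
  assumes f_zero [simp]: "f a b 0 = 0"
    and f_add: "f a b (c + d) = f a b c + f a b d"
begin

lemma bilin_add_left: "bilin_ext f (P + Q) R = bilin_ext f P R + bilin_ext f Q R"
  unfolding bilin_ext_def
  by (rule setsum_keys_plus_distrib) (simp_all add: distrib_right f_add sum.distrib)

lemma bilin_add_right: "bilin_ext f P (Q + R) = bilin_ext f P Q + bilin_ext f P R"
proof -
  have "(\<Sum>b\<in>Poly_Mapping.keys (Q + R).
        f a b (Poly_Mapping.lookup P a * Poly_Mapping.lookup (Q + R) b))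
      = (\<Sum>b\<in>Poly_Mapping.keys Q. f a b (Poly_Mapping.lookup P a * Poly_Mapping.lookup Q b))
      + (\<Sum>b\<in>Poly_Mapping.keys R. f a b (Poly_Mapping.lookup P a * Poly_Mapping.lookup R b))"
    for a
    by (rule setsum_keys_plus_distrib) (simp_all add: distrib_left f_add)
  then show ?thesis unfolding bilin_ext_def by (simp add: sum.distrib)
qed

lemma bilin_zero [simp]: "bilin_ext f 0 Q = 0" "bilin_ext f P 0 = 0"
  by (simp_all add: bilin_ext_def)

lemma bilin_single [simp]:
  "bilin_ext f (Poly_Mapping.single a c) (Poly_Mapping.single b d) = f a b (c * d)"
  by (cases "c = 0"; cases "d = 0") (simp_all add: bilin_ext_def)

lemma bilin_sum_left: "bilin_ext f (sum g S) R = (\<Sum>s\<in>S. bilin_ext f (g s) R)"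
  by (induction S rule: infinite_finite_induct) (simp_all add: bilin_add_left)

lemma bilin_sum_right: "bilin_ext f R (sum g S) = (\<Sum>s\<in>S. bilin_ext f R (g s))"
  by (induction S rule: infinite_finite_induct) (simp_all add: bilin_add_right)

lemma bilin_assoc:
  assumes "\<And>a b e c d g. bilin_ext f (f a b (c * d)) (Poly_Mapping.single e g)
    = bilin_ext f (Poly_Mapping.single a c) (f b e (d * g))"
  shows "bilin_ext f (bilin_ext f P Q) R = bilin_ext f P (bilin_ext f Q R)"
proof (induction P rule: pm_induct)
  case (single a c)
  show ?case
  proof (induction Q rule: pm_induct)
    case (single b d)
    show ?case
      by (induction R rule: pm_induct) (simp_all add: bilin_add_right assms)
  qed (simp_all add: bilin_add_left bilin_add_right)
qed (simp_all add: bilin_add_left)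

end

interpretation mono: pm_additive mono_prod
  by unfold_locales
    (simp_all add: mono_prod_def distrib_right single_add sum.distrib)

interpretation hmono: pm_additive hmono_prod
  by unfold_locales
    (simp_all add: hmono_prod_def distrib_right single_add sum.distrib)

definition cc :: "nat \<Rightarrow> nat \<Rightarrow> nat \<Rightarrow> nat"
  where "cc b c k = fact k * (b choose k) * (c choose k)"

lemma cc_term:
  "cc b c k * (fact (i + j) * (b - k choose i) * (d choose j) * (e choose (i + j)))
    = cc d e j * (fact (i + k) * (b choose (i + k)) * (c choose k) * (e - j choose i))"
proof -
  have A: "fact k * (b choose k) * (b - k choose i) * fact i = fact (i + k) * (b choose (i + k))"
    for b k i :: nat
  proof (cases "i + k \<le> b")
    case True
    have "(b choose (i + k)) * ((i + k) choose k) = (b choose k) * ((b - k) choose i)"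
      using choose_mult[of k "i + k" b] True by simp
    moreover have "fact k * fact i * ((i + k) choose k) = fact (i + k)"
      using binomial_fact_lemma[of k "i + k"] by simp
    ultimately show ?thesis by (metis mult.assoc mult.commute)
  next
    case False
    then have "b < k \<or> b - k < i" "b < i + k" by auto
    then show ?thesis by (auto simp: binomial_eq_0)
  qed
  have "cc b c k * (fact (i + j) * (b - k choose i) * (d choose j) * (e choose (i + j))) * fact i
    = (fact k * (b choose k) * (b - k choose i) * fact i) * (c choose k) * (d choose j)
        * (fact (i + j) * (e choose (i + j)))"
    by (simp add: cc_def ac_simps)
  also have "\<dots> = (fact (i + k) * (b choose (i + k))) * (c choose k) * (d choose j)
        * (fact j * (e choose j) * (e - j choose i) * fact i)"
    by (simp only: A)
  also have "\<dots> = cc d e j * (fact (i + k) * (b choose (i + k)) * (c choose k) * (e - j choose i))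
        * fact i"
    by (simp add: cc_def ac_simps)
  finally show ?thesis by simp
qed

lemma cc_assoc:
  "(\<Sum>k\<le>t. cc b c k * cc (b + d - k) e (t - k)) = (\<Sum>j\<le>t. cc d e j * cc b (c + e - j) (t - j))"
proof -
  define T where "T k j = cc b c k * (fact (t - k) * (b - k choose (t - k - j)) * (d choose j)
    * (e choose (t - k)))" for k j
  define T' where "T' j k = cc d e j * (fact (t - j) * (b choose (t - j)) * (c choose k)
    * (e - j choose (t - j - k)))" for j k
  have 1: "cc b c k * cc (b + d - k) e (t - k) = (\<Sum>j\<le>t - k. T k j)" for k
  proof (cases "k \<le> b")
    case True
    then have "(b + d - k choose (t - k)) = (\<Sum>j\<le>t - k. (d choose j) * (b - k choose (t - k - j)))"
      by (subst vandermonde) (simp add: add.commute)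
    then show ?thesis
      by (simp add: T_def cc_def sum_distrib_left sum_distrib_right ac_simps)
  next
    case False
    then show ?thesis by (simp add: T_def cc_def binomial_eq_0)
  qed
  have 2: "cc d e j * cc b (c + e - j) (t - j) = (\<Sum>k\<le>t - j. T' j k)" for j
  proof (cases "j \<le> e")
    case True
    then have "(c + e - j choose (t - j)) = (\<Sum>k\<le>t - j. (c choose k) * (e - j choose (t - j - k)))"
      by (subst vandermonde) simp
    then show ?thesis
      by (simp add: T'_def cc_def sum_distrib_left sum_distrib_right ac_simps)
  next
    case False
    then show ?thesis by (simp add: T'_def cc_def binomial_eq_0)
  qed
  have 3: "T k j = T' j k" if "k + j \<le> t" for k j
    using cc_term[of b c k "t - k - j" j d e] that by (simp add: T_def T'_def add.commute)
  have "(\<Sum>k\<le>t. \<Sum>j\<le>t - k. T k j) = (\<Sum>(k, j)\<in>Sigma {..t} (\<lambda>k. {..t - k}). T k j)"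
    by (simp add: sum.Sigma)
  also have "\<dots> = (\<Sum>(j, k)\<in>Sigma {..t} (\<lambda>j. {..t - j}). T' j k)"
    by (rule sum.reindex_bij_witness[where i = prod.swap and j = prod.swap]) (auto simp: 3)
  also have "\<dots> = (\<Sum>j\<le>t. \<Sum>k\<le>t - j. T' j k)"
    by (simp add: sum.Sigma)
  finally show ?thesis by (simp add: 1 2)
qed

lemma finite_le_fun: "finite {\<kappa> :: 'n::finite \<Rightarrow> nat. \<kappa> \<le> M}"
proof -
  have "{\<kappa>. \<kappa> \<le> M} = PiE UNIV (\<lambda>i. {..M i})"
    by (auto simp: PiE_UNIV_domain le_fun_def)
  then show ?thesis by (simp add: finite_PiE)
qed

lemma finite_contractions [simp]: "finite (contractions \<alpha> (\<beta> :: 'n::finite expo))"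
  by (rule finite_subset[OF _ finite_le_fun[of "\<lambda>i. \<alpha> (Inr i)"]])
    (auto simp: contractions_def le_fun_def)

lemma contr_coeff_cc: "contr_coeff \<alpha> \<beta> \<kappa> = (\<Prod>i\<in>UNIV. cc (\<alpha> (Inr i)) (\<beta> (Inl i)) (\<kappa> i))"
  by (simp add: contr_coeff_def cc_def)

lemma contr_coeff_eq_0: "\<kappa> \<notin> contractions \<alpha> \<beta> \<Longrightarrow> contr_coeff \<alpha> \<beta> \<kappa> = 0"
  by (auto simp: contractions_def contr_coeff_def not_le)

text \<open>Sums over pairs of contractions, collected by their total contraction.\<close>

lemma sum_pairs:
  fixes F :: "('n::finite \<Rightarrow> nat) \<Rightarrow> ('n \<Rightarrow> nat) \<Rightarrow> 'b::comm_monoid_add"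
  assumes "finite A" "\<And>\<kappa>. finite (B \<kappa>)"
    and "\<And>\<kappa> \<mu>. \<kappa> \<in> A \<Longrightarrow> \<mu> \<in> B \<kappa> \<Longrightarrow> \<kappa> + \<mu> \<le> M"
    and "\<And>\<kappa> \<mu>. \<kappa> \<notin> A \<or> \<mu> \<notin> B \<kappa> \<Longrightarrow> F \<kappa> \<mu> = 0"
  shows "(\<Sum>\<kappa>\<in>A. \<Sum>\<mu>\<in>B \<kappa>. F \<kappa> \<mu>)
    = (\<Sum>\<theta>\<in>{\<theta>. \<theta> \<le> M}. \<Sum>\<kappa>\<in>{\<kappa>. \<kappa> \<le> \<theta>}. F \<kappa> (\<lambda>i. \<theta> i - \<kappa> i))"
proof -
  have "(\<Sum>\<kappa>\<in>A. \<Sum>\<mu>\<in>B \<kappa>. F \<kappa> \<mu>) = (\<Sum>(\<kappa>, \<mu>)\<in>Sigma A B. F \<kappa> \<mu>)"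
    using assms(1,2) by (simp add: sum.Sigma)
  also have "\<dots> = (\<Sum>(\<theta>, \<kappa>)\<in>{(\<theta>, \<kappa>). \<theta> \<le> M \<and> \<kappa> \<in> A \<and> \<kappa> \<le> \<theta> \<and> (\<lambda>i. \<theta> i - \<kappa> i) \<in> B \<kappa>}.
      F \<kappa> (\<lambda>i. \<theta> i - \<kappa> i))"
  proof (rule sum.reindex_bij_witness[where
        i = "\<lambda>(\<theta>, \<kappa>). (\<kappa>, \<lambda>i. \<theta> i - \<kappa> i)" and j = "\<lambda>(\<kappa>, \<mu>). (\<kappa> + \<mu>, \<kappa>)"])
  qed (auto simp: le_fun_def fun_eq_iff assms(3)[unfolded le_fun_def, simplified])
  also have "\<dots> = (\<Sum>(\<theta>, \<kappa>)\<in>Sigma {\<theta>. \<theta> \<le> M} (\<lambda>\<theta>. {\<kappa>. \<kappa> \<le> \<theta>}). F \<kappa> (\<lambda>i. \<theta> i - \<kappa> i))"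
    by (rule sum.mono_neutral_left) (auto intro!: finite_SigmaI finite_le_fun assms(4))
  also have "\<dots> = (\<Sum>\<theta>\<in>{\<theta>. \<theta> \<le> M}. \<Sum>\<kappa>\<in>{\<kappa>. \<kappa> \<le> \<theta>}. F \<kappa> (\<lambda>i. \<theta> i - \<kappa> i))"
    by (simp add: sum.Sigma finite_le_fun)
  finally show ?thesis .
qed

lemma sum_prod_le:
  fixes f :: "'n::finite \<Rightarrow> nat \<Rightarrow> nat"
  shows "(\<Sum>\<kappa>\<in>{\<kappa>. \<kappa> \<le> \<theta>}. \<Prod>i\<in>UNIV. f i (\<kappa> i)) = (\<Prod>i\<in>UNIV. \<Sum>k\<le>\<theta> i. f i k)"
proof -
  have "{\<kappa>. \<kappa> \<le> \<theta>} = PiE UNIV (\<lambda>i. {..\<theta> i})"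
    by (auto simp: PiE_UNIV_domain le_fun_def)
  then show ?thesis by (simp add: prod_sum_PiE)
qed

lemma contr_coeff_assoc:
  fixes \<alpha> \<beta> \<gamma> :: "'n::finite expo"
  shows "(\<Sum>\<kappa>\<in>{\<kappa>. \<kappa> \<le> \<theta>}.
        contr_coeff \<alpha> \<beta> \<kappa> * contr_coeff (contr_expo \<alpha> \<beta> \<kappa>) \<gamma> (\<lambda>i. \<theta> i - \<kappa> i))
    = (\<Sum>\<mu>\<in>{\<mu>. \<mu> \<le> \<theta>}.
        contr_coeff \<beta> \<gamma> \<mu> * contr_coeff \<alpha> (contr_expo \<beta> \<gamma> \<mu>) (\<lambda>i. \<theta> i - \<mu> i))"
  using sum_prod_le[of "\<lambda>i k. cc (\<alpha> (Inr i)) (\<beta> (Inl i)) k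
      * cc (\<alpha> (Inr i) + \<beta> (Inr i) - k) (\<gamma> (Inl i)) (\<theta> i - k)" \<theta>]
    sum_prod_le[of "\<lambda>i j. cc (\<beta> (Inr i)) (\<gamma> (Inl i)) j
      * cc (\<alpha> (Inr i)) (\<beta> (Inl i) + \<gamma> (Inl i) - j) (\<theta> i - j)" \<theta>]
  by (simp add: contr_coeff_cc contr_expo_def prod.distrib[symmetric] cc_assoc)

lemma single_of_nat_sum:
  "Poly_Mapping.single x (r * of_nat (sum f S) :: 'k::comm_ring_1)
    = (\<Sum>s\<in>S. Poly_Mapping.single x (r * of_nat (f s)))"
  by (induction S rule: infinite_finite_induct) (simp_all add: distrib_left single_add)

lemma add_minus_le: "\<kappa> \<le> \<theta> \<Longrightarrow> \<kappa> + (\<lambda>i. \<theta> i - \<kappa> i) = (\<theta> :: 'n \<Rightarrow> nat)"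
  by (auto simp: le_fun_def fun_eq_iff)

lemma hmono_assoc:
  fixes a b e :: "'n::finite hexpo" and c d g :: "'k::comm_ring_1"
  shows "bilin_ext hmono_prod (hmono_prod a b (c * d)) (Poly_Mapping.single e g)
    = bilin_ext hmono_prod (Poly_Mapping.single a c) (hmono_prod b e (d * g))"
proof -
  obtain l \<alpha> where a: "a = (l, \<alpha>)" by (cases a)
  obtain m \<beta> where b: "b = (m, \<beta>)" by (cases b)
  obtain p \<gamma> where e: "e = (p, \<gamma>)" by (cases e)
  define M where "M = (\<lambda>i. \<alpha> (Inr i) + \<beta> (Inr i) + \<gamma> (Inl i) + \<beta> (Inl i))"
  define E :: "('n \<Rightarrow> nat) \<Rightarrow> 'n hexpo" where "E \<theta> = (l + m + p + 2 * (\<Sum>i\<in>UNIV. \<theta> i),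
      \<lambda>v. \<alpha> v + \<beta> v + \<gamma> v - case_sum \<theta> \<theta> v)" for \<theta>
  let ?s = "\<lambda>\<theta> k. Poly_Mapping.single (E \<theta>) (c * d * g * of_nat k)"
  have s0: "?s \<theta> 0 = 0" for \<theta> by simp
  have E1: "E (\<kappa> + \<mu>) = (l + m + 2 * (\<Sum>i\<in>UNIV. \<kappa> i) + p + 2 * (\<Sum>i\<in>UNIV. \<mu> i),
      contr_expo (contr_expo \<alpha> \<beta> \<kappa>) \<gamma> \<mu>)" if "\<kappa> \<in> contractions \<alpha> \<beta>" for \<kappa> \<mu>
  proof -
    have "\<alpha> v + \<beta> v + \<gamma> v - case_sum (\<kappa> + \<mu>) (\<kappa> + \<mu>) v
      = \<alpha> v + \<beta> v - case_sum \<kappa> \<kappa> v + \<gamma> v - case_sum \<mu> \<mu> v" for v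
    proof -
      have "case_sum \<kappa> \<kappa> v \<le> \<alpha> v + \<beta> v"
        using that by (auto simp: contractions_def trans_le_add1 trans_le_add2 split: sum.split)
      moreover have "case_sum (\<kappa> + \<mu>) (\<kappa> + \<mu>) v = case_sum \<kappa> \<kappa> v + case_sum \<mu> \<mu> v"
        by (simp split: sum.split)
      ultimately show ?thesis by simp
    qed
    then show ?thesis by (simp add: E_def contr_expo_def sum.distrib)
  qed
  have E2: "E (\<mu> + \<kappa>) = (l + (m + p + 2 * (\<Sum>i\<in>UNIV. \<mu> i)) + 2 * (\<Sum>i\<in>UNIV. \<kappa> i),
      contr_expo \<alpha> (contr_expo \<beta> \<gamma> \<mu>) \<kappa>)" if "\<mu> \<in> contractions \<beta> \<gamma>" for \<kappa> \<mu>
  proof -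
    have "\<alpha> v + \<beta> v + \<gamma> v - case_sum (\<mu> + \<kappa>) (\<mu> + \<kappa>) v
      = \<alpha> v + (\<beta> v + \<gamma> v - case_sum \<mu> \<mu> v) - case_sum \<kappa> \<kappa> v" for v
    proof -
      have "case_sum \<mu> \<mu> v \<le> \<beta> v + \<gamma> v"
        using that by (auto simp: contractions_def trans_le_add1 trans_le_add2 split: sum.split)
      moreover have "case_sum (\<mu> + \<kappa>) (\<mu> + \<kappa>) v = case_sum \<kappa> \<kappa> v + case_sum \<mu> \<mu> v"
        by (simp split: sum.split)
      ultimately show ?thesis by simp
    qed
    then show ?thesis by (simp add: E_def contr_expo_def sum.distrib)
  qed
  have "bilin_ext hmono_prod (hmono_prod a b (c * d)) (Poly_Mapping.single e g)
    = (\<Sum>\<kappa>\<in>contractions \<alpha> \<beta>. \<Sum>\<mu>\<in>contractions (contr_expo \<alpha> \<beta> \<kappa>) \<gamma>.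
        ?s (\<kappa> + \<mu>) (contr_coeff \<alpha> \<beta> \<kappa> * contr_coeff (contr_expo \<alpha> \<beta> \<kappa>) \<gamma> \<mu>))"
    unfolding a b e hmono_prod_def fst_conv snd_conv hmono.bilin_sum_left hmono.bilin_single
    unfolding hmono_prod_def fst_conv snd_conv
    by (intro sum.cong refl) (simp add: E1 algebra_simps)
  also have "\<dots> = (\<Sum>\<theta>\<in>{\<theta>. \<theta> \<le> M}. \<Sum>\<kappa>\<in>{\<kappa>. \<kappa> \<le> \<theta>}. ?s (\<kappa> + (\<lambda>i. \<theta> i - \<kappa> i))
        (contr_coeff \<alpha> \<beta> \<kappa> * contr_coeff (contr_expo \<alpha> \<beta> \<kappa>) \<gamma> (\<lambda>i. \<theta> i - \<kappa> i)))"
  proof (rule sum_pairs)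
    show "\<kappa> + \<mu> \<le> M" if "\<kappa> \<in> contractions \<alpha> \<beta>" "\<mu> \<in> contractions (contr_expo \<alpha> \<beta> \<kappa>) \<gamma>" for \<kappa> \<mu>
    proof (rule le_funI)
      fix i
      have "\<kappa> i \<le> \<alpha> (Inr i)" "\<mu> i \<le> \<gamma> (Inl i)" using that by (auto simp: contractions_def)
      then show "(\<kappa> + \<mu>) i \<le> M i" by (simp add: M_def)
    qed
  qed (auto dest: contr_coeff_eq_0)
  also have "\<dots> = (\<Sum>\<theta>\<in>{\<theta>. \<theta> \<le> M}. ?s \<theta> (\<Sum>\<kappa>\<in>{\<kappa>. \<kappa> \<le> \<theta>}.
        contr_coeff \<alpha> \<beta> \<kappa> * contr_coeff (contr_expo \<alpha> \<beta> \<kappa>) \<gamma> (\<lambda>i. \<theta> i - \<kappa> i)))"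
    unfolding single_of_nat_sum
    by (intro sum.cong refl) (simp only: add_minus_le mem_Collect_eq)
  also have "\<dots> = (\<Sum>\<theta>\<in>{\<theta>. \<theta> \<le> M}. ?s \<theta> (\<Sum>\<mu>\<in>{\<mu>. \<mu> \<le> \<theta>}.
        contr_coeff \<beta> \<gamma> \<mu> * contr_coeff \<alpha> (contr_expo \<beta> \<gamma> \<mu>) (\<lambda>i. \<theta> i - \<mu> i)))"
    by (simp only: contr_coeff_assoc)
  also have "\<dots> = (\<Sum>\<theta>\<in>{\<theta>. \<theta> \<le> M}. \<Sum>\<mu>\<in>{\<mu>. \<mu> \<le> \<theta>}. ?s (\<mu> + (\<lambda>i. \<theta> i - \<mu> i))
        (contr_coeff \<beta> \<gamma> \<mu> * contr_coeff \<alpha> (contr_expo \<beta> \<gamma> \<mu>) (\<lambda>i. \<theta> i - \<mu> i)))"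
    unfolding single_of_nat_sum
    by (intro sum.cong refl) (simp only: add_minus_le mem_Collect_eq)
  also have "\<dots> = (\<Sum>\<mu>\<in>contractions \<beta> \<gamma>. \<Sum>\<kappa>\<in>contractions \<alpha> (contr_expo \<beta> \<gamma> \<mu>).
        ?s (\<mu> + \<kappa>) (contr_coeff \<beta> \<gamma> \<mu> * contr_coeff \<alpha> (contr_expo \<beta> \<gamma> \<mu>) \<kappa>))"
  proof (rule sum_pairs[symmetric])
    show "\<mu> + \<kappa> \<le> M" if "\<mu> \<in> contractions \<beta> \<gamma>" "\<kappa> \<in> contractions \<alpha> (contr_expo \<beta> \<gamma> \<mu>)" for \<kappa> \<mu>
    proof (rule le_funI)
      fix i
      have "\<kappa> i \<le> \<alpha> (Inr i)" "\<mu> i \<le> \<gamma> (Inl i)" using that by (auto simp: contractions_def)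
      then show "(\<mu> + \<kappa>) i \<le> M i" by (simp add: M_def)
    qed
  qed (auto dest: contr_coeff_eq_0)
  also have "\<dots> = bilin_ext hmono_prod (Poly_Mapping.single a c) (hmono_prod b e (d * g))"
    unfolding a b e hmono_prod_def fst_conv snd_conv hmono.bilin_sum_right hmono.bilin_single
    unfolding hmono_prod_def fst_conv snd_conv
    by (intro sum.cong refl) (simp add: E2 algebra_simps)
  finally show ?thesis .
qed

text \<open>Setting \<open>h = 1\<close>, on coefficient functions.\<close>

definition dehom :: "('n hexpo \<Rightarrow>\<^sub>0 'k) \<Rightarrow> ('n expo \<Rightarrow>\<^sub>0 'k::comm_ring_1)"
  where "dehom P = (\<Sum>e\<in>Poly_Mapping.keys P.
    Poly_Mapping.single (snd e) (Poly_Mapping.lookup P e))"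

lemma dehom_add: "dehom (P + Q) = dehom P + dehom Q"
  unfolding dehom_def by (rule setsum_keys_plus_distrib) (simp_all add: single_add)

lemma dehom_zero [simp]: "dehom 0 = 0"
  by (simp add: dehom_def)

lemma dehom_single [simp]: "dehom (Poly_Mapping.single e c) = Poly_Mapping.single (snd e) c"
  by (cases "c = 0") (simp_all add: dehom_def)

lemma dehom_sum: "dehom (sum g S) = (\<Sum>s\<in>S. dehom (g s))"
  by (induction S rule: infinite_finite_induct) (simp_all add: dehom_add)

lemma dehom_hmono_prod: "dehom (hmono_prod a b c) = mono_prod (snd a) (snd b) c"
  by (simp add: hmono_prod_def mono_prod_def dehom_sum)

lemma dehom_mult:
  "dehom (bilin_ext hmono_prod P Q) = bilin_ext mono_prod (dehom P) (dehom (Q :: 'n::finite hexpo \<Rightarrow>\<^sub>0 _))"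
proof (induction P rule: pm_induct)
  case (single a c)
  show ?case
    by (induction Q rule: pm_induct)
      (simp_all add: dehom_add hmono.bilin_add_right mono.bilin_add_right
        dehom_hmono_prod)
qed (simp_all add: dehom_add hmono.bilin_add_left mono.bilin_add_left)

lemma dehom_surj: "\<exists>P. dehom P = p"
proof (induction p rule: pm_induct)
  case (add p q)
  then show ?case by (metis dehom_add)
next
  case (single a c)
  have "dehom (Poly_Mapping.single (0, a) c) = Poly_Mapping.single a c" by simp
  then show ?case by blast
qed (use dehom_zero in blast)

lemma h_assoc:
  "bilin_ext hmono_prod (bilin_ext hmono_prod P Q) R
    = bilin_ext hmono_prod P (bilin_ext hmono_prod Q (R :: 'n::finite hexpo \<Rightarrow>\<^sub>0 _))"
  by (rule hmono.bilin_assoc) (rule hmono_assoc)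

lemma w_assoc:
  "bilin_ext mono_prod (bilin_ext mono_prod p q) r
    = bilin_ext mono_prod p (bilin_ext mono_prod q (r :: 'n::finite expo \<Rightarrow>\<^sub>0 _))"
  using dehom_surj[of p] dehom_surj[of q] dehom_surj[of r]
  by (metis dehom_mult h_assoc)

lemma contractions_zero [simp]:
  "contractions 0 \<beta> = {0}" "contractions \<alpha> 0 = {0}"
  by (auto simp: contractions_def fun_eq_iff)

lemma contr_zero [simp]:
  "contr_coeff \<alpha> \<beta> 0 = 1" "contr_expo \<alpha> \<beta> 0 = \<alpha> + \<beta>"
  by (auto simp: contr_coeff_def contr_expo_def fun_eq_iff split: sum.split)

lemma hmono_prod_one [simp]:
  "hmono_prod 0 b c = Poly_Mapping.single b c" "hmono_prod a 0 c = Poly_Mapping.single a c"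
  by (simp_all add: hmono_prod_def)

lemma mono_prod_one [simp]:
  "mono_prod 0 b c = Poly_Mapping.single b c" "mono_prod a 0 c = Poly_Mapping.single a c"
  by (simp_all add: mono_prod_def)

lemma h_one:
  "bilin_ext hmono_prod (Poly_Mapping.single 0 1) P = P" (is ?A)
  "bilin_ext hmono_prod P (Poly_Mapping.single 0 1) = P" (is ?B)
proof -
  show ?A
    by (induction P rule: pm_induct)
      (simp_all add: hmono.bilin_add_right del: single_one zero_fun_def)
  show ?B
    by (induction P rule: pm_induct)
      (simp_all add: hmono.bilin_add_left del: single_one zero_fun_def)
qed

lemma w_one:
  "bilin_ext mono_prod (Poly_Mapping.single 0 1) p = p"
  "bilin_ext mono_prod p (Poly_Mapping.single 0 1) = p"
proof -
  obtain P where P: "p = dehom P" using dehom_surj by metis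
  show "bilin_ext mono_prod (Poly_Mapping.single 0 1) p = p"
    using dehom_mult[of "Poly_Mapping.single 0 1" P] by (simp only: h_one dehom_single snd_zero P)
  show "bilin_ext mono_prod p (Poly_Mapping.single 0 1) = p"
    using dehom_mult[of P "Poly_Mapping.single 0 1"] by (simp only: h_one dehom_single snd_zero P)
qed

subsection \<open>The ring types\<close>

typedef (overloaded) ('n, 'k::zero) weyl = "UNIV :: ('n expo \<Rightarrow>\<^sub>0 'k) set"
  morphisms coeffs Abs_weyl ..

typedef (overloaded) ('n, 'k::zero) hweyl = "UNIV :: ('n hexpo \<Rightarrow>\<^sub>0 'k) set"
  morphisms hcoeffs Abs_hweyl ..

setup_lifting type_definition_weyl
setup_lifting type_definition_hweyl

instantiation weyl :: (finite, comm_ring_1) ring_1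
begin
lift_definition zero_weyl :: "('a, 'b) weyl" is 0 .
lift_definition one_weyl :: "('a, 'b) weyl" is "Poly_Mapping.single 0 1" .
lift_definition plus_weyl :: "('a, 'b) weyl \<Rightarrow> ('a, 'b) weyl \<Rightarrow> ('a, 'b) weyl" is "(+)" .
lift_definition minus_weyl :: "('a, 'b) weyl \<Rightarrow> ('a, 'b) weyl \<Rightarrow> ('a, 'b) weyl" is "(-)" .
lift_definition uminus_weyl :: "('a, 'b) weyl \<Rightarrow> ('a, 'b) weyl" is uminus .
lift_definition times_weyl :: "('a, 'b) weyl \<Rightarrow> ('a, 'b) weyl \<Rightarrow> ('a, 'b) weyl"
  is "bilin_ext mono_prod" .
instance
proof
  fix a b c :: "('a, 'b) weyl"
  show "a + b + c = a + (b + c)" by transfer (rule add.assoc)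
  show "a + b = b + a" by transfer (rule add.commute)
  show "0 + a = a" by transfer simp
  show "- a + a = 0" by transfer simp
  show "a - b = a + - b" by transfer simp
  show "a * b * c = a * (b * c)" by transfer (rule w_assoc)
  show "1 * a = a" "a * 1 = a" by (transfer, rule w_one)+
  show "(a + b) * c = a * c + b * c" by transfer (rule mono.bilin_add_left)
  show "a * (b + c) = a * b + a * c" by transfer (rule mono.bilin_add_right)
  show "(0 :: ('a, 'b) weyl) \<noteq> 1"
    by transfer (metis lookup_single_eq lookup_zero zero_neq_one)
qed
end

instantiation hweyl :: (finite, comm_ring_1) ring_1
begin
lift_definition zero_hweyl :: "('a, 'b) hweyl" is 0 .
lift_definition one_hweyl :: "('a, 'b) hweyl" is "Poly_Mapping.single 0 1" .
lift_definition plus_hweyl :: "('a, 'b) hweyl \<Rightarrow> ('a, 'b) hweyl \<Rightarrow> ('a, 'b) hweyl" is "(+)" .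
lift_definition minus_hweyl :: "('a, 'b) hweyl \<Rightarrow> ('a, 'b) hweyl \<Rightarrow> ('a, 'b) hweyl" is "(-)" .
lift_definition uminus_hweyl :: "('a, 'b) hweyl \<Rightarrow> ('a, 'b) hweyl" is uminus .
lift_definition times_hweyl :: "('a, 'b) hweyl \<Rightarrow> ('a, 'b) hweyl \<Rightarrow> ('a, 'b) hweyl"
  is "bilin_ext hmono_prod" .
instance
proof
  fix a b c :: "('a, 'b) hweyl"
  show "a + b + c = a + (b + c)" by transfer (rule add.assoc)
  show "a + b = b + a" by transfer (rule add.commute)
  show "0 + a = a" by transfer simp
  show "- a + a = 0" by transfer simp
  show "a - b = a + - b" by transfer simp
  show "a * b * c = a * (b * c)" by transfer (rule h_assoc)
  show "1 * a = a" "a * 1 = a" by (transfer, rule h_one)+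
  show "(a + b) * c = a * c + b * c" by transfer (rule hmono.bilin_add_left)
  show "a * (b + c) = a * b + a * c" by transfer (rule hmono.bilin_add_right)
  show "(0 :: ('a, 'b) hweyl) \<noteq> 1"
    by transfer (metis lookup_single_eq lookup_zero zero_neq_one)
qed
end


lift_definition coeff :: "('n::finite, 'k::comm_ring_1) weyl \<Rightarrow> 'n expo \<Rightarrow> 'k"
  is Poly_Mapping.lookup .

lift_definition hcoeff :: "('n::finite, 'k::comm_ring_1) hweyl \<Rightarrow> 'n hexpo \<Rightarrow> 'k"
  is Poly_Mapping.lookup .

lift_definition mon :: "'n::finite expo \<Rightarrow> 'k \<Rightarrow> ('n, 'k::comm_ring_1) weyl"
  is Poly_Mapping.single .

lift_definition hmon :: "'n::finite hexpo \<Rightarrow> 'k \<Rightarrow> ('n, 'k::comm_ring_1) hweyl"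
  is Poly_Mapping.single .

text \<open>\<open>\<rho>\<close>, the substitution \<open>h = 1\<close>.\<close>

lift_definition rho :: "('n::finite, 'k::comm_ring_1) hweyl \<Rightarrow> ('n, 'k) weyl"
  is dehom .

definition wX :: "'n::finite \<Rightarrow> ('n, 'k::comm_ring_1) weyl"
  where "wX i = mon (unit_expo (Inl i)) 1"
definition wD :: "'n::finite \<Rightarrow> ('n, 'k::comm_ring_1) weyl"
  where "wD i = mon (unit_expo (Inr i)) 1"
definition hH :: "('n::finite, 'k::comm_ring_1) hweyl"
  where "hH = hmon (1, 0) 1"
definition hX :: "'n::finite \<Rightarrow> ('n, 'k::comm_ring_1) hweyl"
  where "hX i = hmon (0, unit_expo (Inl i)) 1"
definition hD :: "'n::finite \<Rightarrow> ('n, 'k::comm_ring_1) hweyl"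
  where "hD i = hmon (0, unit_expo (Inr i)) 1"

lemma finite_coeff [simp]: "finite {\<alpha>. coeff P \<alpha> \<noteq> 0}"
  by transfer simp

lemma finite_hcoeff [simp]: "finite {e. hcoeff P e \<noteq> 0}"
  by transfer simp

lemma coeff_simps [simp]:
  "coeff 0 \<alpha> = 0" "coeff (P + Q) \<alpha> = coeff P \<alpha> + coeff Q \<alpha>"
  "coeff (- P) \<alpha> = - coeff P \<alpha>" "coeff (P - Q) \<alpha> = coeff P \<alpha> - coeff Q \<alpha>"
  "coeff (mon \<beta> c) \<alpha> = (if \<alpha> = \<beta> then c else 0)"
  by (transfer; simp add: lookup_add lookup_minus lookup_single when_def)+

lemma hcoeff_simps [simp]:
  "hcoeff 0 e = 0" "hcoeff (P + Q) e = hcoeff P e + hcoeff Q e"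
  "hcoeff (- P) e = - hcoeff P e" "hcoeff (P - Q) e = hcoeff P e - hcoeff Q e"
  "hcoeff (hmon d c) e = (if e = d then c else 0)"
  by (transfer; simp add: lookup_add lookup_minus lookup_single when_def)+

lemma weyl_eqI: "(\<And>\<alpha>. coeff P \<alpha> = coeff Q \<alpha>) \<Longrightarrow> P = Q"
  by transfer (rule poly_mapping_eqI)

lemma hweyl_eqI: "(\<And>e. hcoeff P e = hcoeff Q e) \<Longrightarrow> P = Q"
  by transfer (rule poly_mapping_eqI)

lemma coeff_sum: "coeff (sum f S) \<alpha> = (\<Sum>s\<in>S. coeff (f s) \<alpha>)"
  by (induction S rule: infinite_finite_induct) simp_all

lemma hcoeff_sum: "hcoeff (sum f S) e = (\<Sum>s\<in>S. hcoeff (f s) e)"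
  by (induction S rule: infinite_finite_induct) simp_all

lemma weyl_expand: "P = (\<Sum>\<alpha>\<in>{\<alpha>. coeff P \<alpha> \<noteq> 0}. mon \<alpha> (coeff P \<alpha>))"
  by (rule weyl_eqI) (simp add: coeff_sum)

lemma hweyl_expand: "P = (\<Sum>e\<in>{e. hcoeff P e \<noteq> 0}. hmon e (hcoeff P e))"
  by (rule hweyl_eqI) (simp add: hcoeff_sum)

lemma rho_simps [simp]:
  "rho 0 = 0" "rho 1 = 1" "rho (P + Q) = rho P + rho Q" "rho (P * Q) = rho P * rho Q"
  "rho (hmon e c) = mon (snd e) c"
  by (transfer, simp add: dehom_add dehom_mult del: single_one)+

lemma rho_generators: "rho hH = 1" "rho (hX i) = wX i" "rho (hD i) = wD i"
  unfolding hH_def hX_def hD_def wX_def wD_def rho_simps snd_conv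
  by (transfer, rule refl)+

lemma hmon_mult_hmon: "hmon a c * hmon b d = Abs_hweyl (hmono_prod a b (c * d))"
  by (simp add: times_hweyl_def hmon.rep_eq)

lemma contractions_left:
  "(\<And>i. \<alpha> (Inr i) = 0) \<Longrightarrow> contractions \<alpha> \<beta> = {0}"
  by (auto simp: contractions_def fun_eq_iff)

lemma contractions_right:
  "(\<And>i. \<beta> (Inl i) = 0) \<Longrightarrow> contractions \<alpha> \<beta> = {0}"
  by (auto simp: contractions_def fun_eq_iff)

lemma hmon_mult_uncontracted:
  assumes "contractions (snd a) (snd b) = {0}"
  shows "hmon a c * hmon b d = hmon (a + b) (c * d)"
  unfolding hmon_mult_hmon hmono_prod_def assms by (simp add: hmon.abs_eq plus_prod_def)

text \<open>Basis monomials are the ordered products \<open>h\<^sup>\<lambda> x\<^sup>a \<partial>\<^sup>b\<close>.\<close>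

lemma hmon_normal_form:
  "hmon (0, 0) 1 = 1"
  "hmon (0, 0) c * hmon e d = hmon e (c * d)"
  "hH * hmon e c = hmon ((1, 0) + e) c"
  "hX i * hmon e c = hmon ((0, unit_expo (Inl i)) + e) c"
  "hmon e c * hD i = hmon (e + (0, unit_expo (Inr i))) c"
proof -
  show "hmon (0, 0) 1 = 1"
    by transfer (simp add: zero_prod_def[symmetric] del: single_one)
  show "hmon (0, 0) c * hmon e d = hmon e (c * d)"
    by (subst hmon_mult_uncontracted) (simp_all flip: zero_prod_def)
  show "hH * hmon e c = hmon ((1, 0) + e) c"
    unfolding hH_def by (subst hmon_mult_uncontracted) simp_all
  show "hX i * hmon e c = hmon ((0, unit_expo (Inl i)) + e) c"
    unfolding hX_def
    by (subst hmon_mult_uncontracted) (simp_all add: contractions_left unit_expo_def)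
  show "hmon e c * hD i = hmon (e + (0, unit_expo (Inr i))) c"
    unfolding hD_def
    by (subst hmon_mult_uncontracted) (simp_all add: contractions_right unit_expo_def)
qed

lemma hmon_central_aux: "hmon (l, 0) c * P = P * hmon (l, 0) c"
proof -
  have "hmon (l, 0) c * hmon e d = hmon e d * hmon (l, 0) c" for e d
    by (simp add: hmon_mult_uncontracted ac_simps)
  then have "(\<Sum>e\<in>{e. hcoeff P e \<noteq> 0}. hmon (l, 0) c * hmon e (hcoeff P e))
      = (\<Sum>e\<in>{e. hcoeff P e \<noteq> 0}. hmon e (hcoeff P e) * hmon (l, 0) c)"
    by (intro sum.cong refl)
  then have "hmon (l, 0) c * (\<Sum>e\<in>{e. hcoeff P e \<noteq> 0}. hmon e (hcoeff P e))
      = (\<Sum>e\<in>{e. hcoeff P e \<noteq> 0}. hmon e (hcoeff P e)) * hmon (l, 0) c"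
    by (simp only: sum_distrib_left sum_distrib_right)
  then show ?thesis by (simp only: hweyl_expand[symmetric])
qed

lemma hH_central: "hH * P = P * hH"
  unfolding hH_def by (rule hmon_central_aux)

lemma hscalar_central: "hmon (0, 0) c * P = P * hmon (0, 0) c"
  by (rule hmon_central_aux)

lemma hX_hX: "hX i * hX j = hX j * hX i"
  unfolding hX_def
  by (simp add: hmon_mult_uncontracted contractions_left unit_expo_def add.commute)

lemma hD_hD: "hD i * hD j = hD j * hD i"
  unfolding hD_def
  by (simp add: hmon_mult_uncontracted contractions_right unit_expo_def add.commute)

lemma hX_hD:
  fixes i j :: "'n::finite"
  shows "hX i * hD j - hD j * hX i
    = (if i = j then - (hH ^ 2) else 0 :: ('n, 'k::comm_ring_1) hweyl)"
proof (cases "i = j")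
  case False
  then have "contractions (unit_expo (Inr j)) (unit_expo (Inl i)) = {0}"
    by (auto simp: contractions_def unit_expo_def fun_eq_iff split: if_splits)
  then show ?thesis using False
    by (simp add: hX_def hD_def hmon_mult_uncontracted contractions_left unit_expo_def
        add.commute)
next
  case True
  let ?\<delta> = "\<lambda>k. if k = i then 1 else 0 :: nat"
  have c: "contractions (unit_expo (Inr i)) (unit_expo (Inl i)) = {0, ?\<delta>}"
  proof -
    have "\<kappa> \<in> {0, ?\<delta>}" if "\<forall>k. \<kappa> k \<le> ?\<delta> k" for \<kappa>
    proof (cases "\<kappa> i = 0")
      case True
      then have "\<kappa> k = 0" for k using that[rule_format, of k] by (cases "k = i") auto
      then show ?thesis by (simp add: fun_eq_iff)
    next
      case False
      then have "\<kappa> k = ?\<delta> k" for k using that[rule_format, of k] by (cases "k = i") auto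
      then have "\<kappa> = ?\<delta>" by blast
      then show ?thesis by simp
    qed
    then have "{\<kappa>. \<forall>k. \<kappa> k \<le> ?\<delta> k} \<subseteq> {0, ?\<delta>}" by blast
    moreover have "{0, ?\<delta>} \<subseteq> {\<kappa>. \<forall>k. \<kappa> k \<le> ?\<delta> k}" by auto
    moreover have "contractions (unit_expo (Inr i)) (unit_expo (Inl i)) = {\<kappa>. \<forall>k. \<kappa> k \<le> ?\<delta> k}"
      by (auto simp: contractions_def unit_expo_def)
    ultimately show ?thesis by (simp only: subset_antisym)
  qed
  have ne: "0 \<noteq> ?\<delta>" by (auto simp: fun_eq_iff)
  have cf: "contr_coeff (unit_expo (Inr i)) (unit_expo (Inl i)) ?\<delta> = 1"
    unfolding contr_coeff_def unit_expo_def by (rule prod.neutral) simp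
  have ce: "contr_expo (unit_expo (Inr i)) (unit_expo (Inl i)) ?\<delta> = 0"
    by (auto simp: contr_expo_def unit_expo_def fun_eq_iff split: sum.split)
  have "hD i * hX i = (hmon (0, unit_expo (Inr i) + unit_expo (Inl i)) 1 + hmon (2, 0) 1 :: ('n, 'k) hweyl)"
    unfolding hX_def hD_def hmon_mult_hmon hmono_prod_def fst_conv snd_conv c
    using ne by (simp add: cf ce hmon.abs_eq plus_hweyl.abs_eq)
  moreover have "hX i * hD i = (hmon (0, unit_expo (Inr i) + unit_expo (Inl i)) 1 :: ('n, 'k) hweyl)"
    by (simp add: hX_def hD_def hmon_mult_uncontracted contractions_left unit_expo_def
        add.commute)
  moreover have "hH ^ 2 = (hmon (2, 0) 1 :: ('n, 'k) hweyl)"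
    by (simp add: hH_def power2_eq_square hmon_mult_uncontracted numeral_2_eq_2)
  ultimately show ?thesis using True by (simp add: algebra_simps)
qed

text \<open>The corresponding facts for the Weyl algebra follow by applying \<^const>\<open>rho\<close>.\<close>

lemma mon_normal_form:
  "mon 0 1 = 1"
  "mon 0 c * mon \<alpha> d = mon \<alpha> (c * d)"
  "wX i * mon \<alpha> c = mon (unit_expo (Inl i) + \<alpha>) c"
  "mon \<alpha> c * wD i = mon (\<alpha> + unit_expo (Inr i)) c"
  using arg_cong[OF hmon_normal_form(1), of rho]
    arg_cong[OF hmon_normal_form(2)[of c "(0, \<alpha>)" d], of rho]
    arg_cong[OF hmon_normal_form(4)[of i "(0, \<alpha>)" c], of rho]
    arg_cong[OF hmon_normal_form(5)[of "(0, \<alpha>)" c i], of rho]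
  by (simp_all add: rho_generators)

lemma rho_diff: "rho (P - Q) = rho P - rho Q"
  using rho_simps(3)[of "P - Q" Q] by (simp add: algebra_simps)

lemma wX_wX: "wX i * wX j = wX j * wX i"
  using arg_cong[OF hX_hX[of i j], of rho] by (simp add: rho_generators)

lemma wD_wD: "wD i * wD j = wD j * wD i"
  using arg_cong[OF hD_hD[of i j], of rho] by (simp add: rho_generators)

lemma wX_wD: "wX i * wD j - wD j * wX i = (if i = j then - 1 else 0)"
  using arg_cong[OF hX_hD[of i j], of rho] rho_diff[of 0 "hH ^ 2"]
  by (simp add: rho_generators rho_diff power2_eq_square split: if_splits)

lemma scalar_central: "mon 0 c * P = P * mon 0 c"
proof -
  obtain Q where "P = rho Q"
    by (metis dehom_surj rho.abs_eq coeffs_inverse)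
  then show ?thesis using arg_cong[OF hscalar_central[of c Q], of rho] by simp
qed


section \<open>Free modules and left submodules\<close>

text \<open>
  Elements of \<open>A\<^sup>r\<close> are functions on \<open>nat\<close> vanishing outside \<open>{1..r}\<close>.  The submodule
  generated by a set is expressed with the library's \<^const>\<open>hull\<close>.
\<close>

definition fmod :: "nat \<Rightarrow> (nat \<Rightarrow> 'a::zero) set"
  where "fmod r = {P. \<forall>i. i \<notin> {1..r} \<longrightarrow> P i = 0}"

definition lscale :: "'a::times \<Rightarrow> (nat \<Rightarrow> 'a) \<Rightarrow> nat \<Rightarrow> 'a"  (infixr \<open>\<odot>\<close> 75)
  where "a \<odot> P = (\<lambda>i. a * P i)"

definition left_submodule :: "nat \<Rightarrow> (nat \<Rightarrow> 'a::ring_1) set \<Rightarrow> bool"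
  where "left_submodule r N \<longleftrightarrow> N \<subseteq> fmod r \<and> 0 \<in> N \<and>
    (\<forall>P\<in>N. \<forall>Q\<in>N. P + Q \<in> N) \<and> (\<forall>a. \<forall>P\<in>N. a \<odot> P \<in> N)"

definition Syz :: "nat \<Rightarrow> (nat \<Rightarrow> nat \<Rightarrow> 'a::ring_1) \<Rightarrow> (nat \<Rightarrow> 'a) set"
  where "Syz s P = {U \<in> fmod s. (\<Sum>k\<in>{1..s}. U k \<odot> P k) = 0}"

definition vrho :: "(nat \<Rightarrow> ('n::finite, 'k::comm_ring_1) hweyl) \<Rightarrow> nat \<Rightarrow> ('n, 'k) weyl"
  where "vrho P = (\<lambda>i. rho (P i))"


section \<open>Filtrations, degrees and homogenization\<close>

definition weight :: "('n::finite + 'n \<Rightarrow> int) \<Rightarrow> 'n expo \<Rightarrow> int"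
  where "weight w \<alpha> = (\<Sum>v\<in>UNIV. w v * int (\<alpha> v))"

definition weyl_filt ::
    "('n::finite + 'n \<Rightarrow> int) \<Rightarrow> int \<Rightarrow> ('n, 'k::comm_ring_1) weyl set"
  where "weyl_filt w \<nu> = {P. \<forall>\<alpha>. coeff P \<alpha> \<noteq> 0 \<longrightarrow> weight w \<alpha> \<le> \<nu>}"

definition module_filt ::
    "('n::finite + 'n \<Rightarrow> int) \<Rightarrow> (nat \<Rightarrow> int) \<Rightarrow> nat \<Rightarrow> int
      \<Rightarrow> (nat \<Rightarrow> ('n, 'k::comm_ring_1) weyl) set"
  where "module_filt w m r k = {P \<in> fmod r. \<forall>i\<in>{1..r}. P i \<in> weyl_filt w (k - m i)}"

text \<open>Only meaningful for \<open>P \<noteq> 0\<close>; then the set of such \<open>k\<close> is bounded below.\<close>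

definition filt_ord ::
    "('n::finite + 'n \<Rightarrow> int) \<Rightarrow> (nat \<Rightarrow> int) \<Rightarrow> nat \<Rightarrow> (nat \<Rightarrow> ('n, 'k::comm_ring_1) weyl) \<Rightarrow> int"
  where "filt_ord w m r P = (LEAST k. P \<in> module_filt w m r k)"

text \<open>Degrees of nonzero elements; zero components do not contribute to the shifted degree.\<close>

definition total_degree :: "('n::finite, 'k::comm_ring_1) hweyl \<Rightarrow> nat"
  where "total_degree P = Max (hdeg ` {e. hcoeff P e \<noteq> 0})"

definition shifted_degree ::
    "(nat \<Rightarrow> int) \<Rightarrow> nat \<Rightarrow> (nat \<Rightarrow> ('n::finite, 'k::comm_ring_1) hweyl) \<Rightarrow> int"
  where "shifted_degree n r P =
    Max ((\<lambda>i. int (total_degree (P i)) + n i) ` {i \<in> {1..r}. P i \<noteq> 0})"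

definition homogeneous :: "('n::finite, 'k::comm_ring_1) hweyl \<Rightarrow> bool"
  where "homogeneous P \<longleftrightarrow> (\<exists>d. \<forall>e. hcoeff P e \<noteq> 0 \<longrightarrow> hdeg e = d)"

definition h_homogeneous ::
    "(nat \<Rightarrow> int) \<Rightarrow> (nat \<Rightarrow> ('n::finite, 'k::comm_ring_1) hweyl) \<Rightarrow> bool"
  where "h_homogeneous n P \<longleftrightarrow>
    (\<exists>d. \<forall>i e. hcoeff (P i) e \<noteq> 0 \<longrightarrow> int (hdeg e) + n i = d)"

definition h_homogenization ::
    "(nat \<Rightarrow> int) \<Rightarrow> nat \<Rightarrow> (nat \<Rightarrow> ('n::finite, 'k::comm_ring_1) weyl) \<Rightarrow> nat \<Rightarrow> ('n, 'k) hweyl"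
  where "h_homogenization n r P =
    (let k = Max {int (tdeg \<alpha>) + n i | \<alpha> i. i \<in> {1..r} \<and> coeff (P i) \<alpha> \<noteq> 0}
     in (\<lambda>i. \<Sum>\<alpha>\<in>{\<alpha>. coeff (P i) \<alpha> \<noteq> 0}.
           hmon (nat (k - int (tdeg \<alpha>) - n i), \<alpha>) (coeff (P i) \<alpha>)))"


section \<open>Orders, leading terms and Groebner bases\<close>

text \<open>Orders are strict relations: \<open>(a, b) \<in> lt\<close> means that \<open>a\<close> is smaller than \<open>b\<close>.\<close>

definition strict_total_order_on :: "'a set \<Rightarrow> 'a rel \<Rightarrow> bool"
  where "strict_total_order_on A lt \<longleftrightarrow> lt \<subseteq> A \<times> A \<and> strict_linear_order_on A lt"

definition monomial_order :: "nat \<Rightarrow> ('n expo \<times> nat) rel \<Rightarrow> bool"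
  where "monomial_order r lt \<longleftrightarrow> strict_total_order_on (UNIV \<times> {1..r}) lt \<and>
    (\<forall>\<alpha> \<beta> \<gamma> i j. ((\<alpha>, i), (\<beta>, j)) \<in> lt \<longrightarrow> ((\<alpha> + \<gamma>, i), (\<beta> + \<gamma>, j)) \<in> lt)"

text \<open>The exponent of \<open>x\<^sub>j \<partial>\<^sub>j\<close>.\<close>

definition xd_expo :: "'n \<Rightarrow> 'n expo"
  where "xd_expo j = unit_expo (Inl j) + unit_expo (Inr j)"

definition adapted ::
    "('n::finite + 'n \<Rightarrow> int) \<Rightarrow> (nat \<Rightarrow> int) \<Rightarrow> nat \<Rightarrow> ('n expo \<times> nat) rel \<Rightarrow> bool"
  where "adapted w m r lt \<longleftrightarrow>
    (\<forall>\<alpha> \<beta>. \<forall>i\<in>{1..r}. \<forall>j\<in>{1..r}.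
       weight w \<alpha> + m i < weight w \<beta> + m j \<longrightarrow> ((\<alpha>, i), (\<beta>, j)) \<in> lt) \<and>
    (\<forall>i\<in>{1..r}. \<forall>j. ((0, i), (xd_expo j, i)) \<in> lt)"

definition h_order ::
    "(nat \<Rightarrow> int) \<Rightarrow> nat \<Rightarrow> ('n::finite expo \<times> nat) rel \<Rightarrow> ('n hexpo \<times> nat) rel"
  where "h_order n r lt = {((a, i), (b, j)) | a i b j. i \<in> {1..r} \<and> j \<in> {1..r} \<and>
    (int (hdeg a) + n i < int (hdeg b) + n j \<or>
     int (hdeg a) + n i = int (hdeg b) + n j \<and> ((snd a, i), (snd b, j)) \<in> lt)}"

definition h_adapted ::
    "('n::finite + 'n \<Rightarrow> int) \<Rightarrow> (nat \<Rightarrow> int) \<Rightarrow> (nat \<Rightarrow> int) \<Rightarrow> nat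
      \<Rightarrow> ('n hexpo \<times> nat) rel \<Rightarrow> bool"
  where "h_adapted w m n s lt \<longleftrightarrow>
    (\<forall>a b. \<forall>i\<in>{1..s}. \<forall>j\<in>{1..s}. int (hdeg a) + n i = int (hdeg b) + n j \<longrightarrow>
       weight w (snd a) + m i < weight w (snd b) + m j \<longrightarrow> ((a, i), (b, j)) \<in> lt) \<and>
    (\<forall>i\<in>{1..s}. \<forall>j. (((2, 0), i), ((0, xd_expo j), i)) \<in> lt)"

definition vcoeff ::
    "(nat \<Rightarrow> ('n::finite, 'k::comm_ring_1) hweyl) \<Rightarrow> 'n hexpo \<times> nat \<Rightarrow> 'k"
  where "vcoeff P e = hcoeff (P (snd e)) (fst e)"

definition lexp ::
    "('n hexpo \<times> nat) rel \<Rightarrow> (nat \<Rightarrow> ('n::finite, 'k::comm_ring_1) hweyl) \<Rightarrow> 'n hexpo \<times> nat"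
  where "lexp lt P = (THE e. vcoeff P e \<noteq> 0 \<and>
    (\<forall>e'. vcoeff P e' \<noteq> 0 \<longrightarrow> e' \<noteq> e \<longrightarrow> (e', e) \<in> lt))"

definition lp ::
    "('n hexpo \<times> nat) rel \<Rightarrow> (nat \<Rightarrow> ('n::finite, 'k::comm_ring_1) hweyl) \<Rightarrow> nat"
  where "lp lt P = snd (lexp lt P)"

definition lcoef ::
    "('n hexpo \<times> nat) rel \<Rightarrow> (nat \<Rightarrow> ('n::finite, 'k::comm_ring_1) hweyl) \<Rightarrow> 'k"
  where "lcoef lt P = vcoeff P (lexp lt P)"

definition expo_shift :: "'n hexpo \<times> nat \<Rightarrow> 'n hexpo \<Rightarrow> 'n hexpo \<times> nat"
  where "expo_shift e \<gamma> = (fst e + \<gamma>, snd e)"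

text \<open>Only used for exponents with equal position.\<close>

definition expo_join :: "'n hexpo \<times> nat \<Rightarrow> 'n hexpo \<times> nat \<Rightarrow> 'n hexpo \<times> nat"
  where "expo_join a b =
    ((max (fst (fst a)) (fst (fst b)), \<lambda>v. max (snd (fst a) v) (snd (fst b) v)), snd a)"

definition is_hmonomial :: "('n::finite, 'k::comm_ring_1) hweyl \<Rightarrow> bool"
  where "is_hmonomial S \<longleftrightarrow> (\<exists>e c. c \<noteq> 0 \<and> S = hmon e c)"

text \<open>Zero elements of \<open>G\<close> have no leading exponent and contribute nothing to the union.\<close>

definition groebner_basis ::
    "nat \<Rightarrow> ('n hexpo \<times> nat) rel \<Rightarrow> (nat \<Rightarrow> ('n::finite, 'k::comm_ring_1) hweyl) set
      \<Rightarrow> (nat \<Rightarrow> ('n, 'k) hweyl) set \<Rightarrow> bool"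
  where "groebner_basis r lt N G \<longleftrightarrow> left_submodule r N \<and> finite G \<and> G \<subseteq> N \<and>
    (\<forall>Q\<in>N. Q \<noteq> 0 \<longrightarrow> lexp lt Q \<in> (\<Union>P\<in>G - {0}. range (expo_shift (lexp lt P))))"


section \<open>The Schreyer order and the syzygies from critical pairs\<close>

definition critical_pairs ::
    "('n hexpo \<times> nat) rel \<Rightarrow> nat \<Rightarrow> (nat \<Rightarrow> nat \<Rightarrow> ('n::finite, 'k::comm_ring_1) hweyl)
      \<Rightarrow> (nat \<times> nat) set"
  where "critical_pairs lt s P = {(i, j). 1 \<le> i \<and> i < j \<and> j \<le> s \<and> lp lt (P i) = lp lt (P j)}"

definition schreyer_order ::
    "('n hexpo \<times> nat) rel \<Rightarrow> nat \<Rightarrow> (nat \<Rightarrow> nat \<Rightarrow> ('n::finite, 'k::comm_ring_1) hweyl)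
      \<Rightarrow> ('n hexpo \<times> nat) rel"
  where "schreyer_order lt s P = {((\<alpha>, \<mu>), (\<beta>, \<nu>)) | \<alpha> \<mu> \<beta> \<nu>. \<mu> \<in> {1..s} \<and> \<nu> \<in> {1..s} \<and>
    ((expo_shift (lexp lt (P \<mu>)) \<alpha>, expo_shift (lexp lt (P \<nu>)) \<beta>) \<in> lt \<or>
     expo_shift (lexp lt (P \<mu>)) \<alpha> = expo_shift (lexp lt (P \<nu>)) \<beta> \<and> \<mu> > \<nu>)}"

definition pair_syzygy ::
    "nat \<Rightarrow> (nat \<Rightarrow> nat \<Rightarrow> 'a::ring_1) \<Rightarrow> (nat \<Rightarrow> nat \<Rightarrow> nat \<Rightarrow> 'a) \<Rightarrow> nat \<Rightarrow> nat \<Rightarrow> nat \<Rightarrow> 'a"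
  where "pair_syzygy s S U i j = (\<lambda>k. if k \<in> {1..s}
    then (if k = i then S j i else if k = j then - S i j else 0) - U i j k else 0)"

end

theory Submission imports Defs
begin

text \<open>
  A contraction replaces some \<open>x\<^sub>j\<partial>\<^sub>j\<close> by \<open>h\<^sup>2\<close>, which is smaller in either order, so leading
  exponents are additive although the algebra is not commutative. If the \<open>P\<^sub>k\<close> satisfy a relation,
  the top exponent of its summands must cancel and hence occurs for two different \<open>k\<close>; therefore
  the leading exponent of the relation is a multiple of that of some \<open>V\<^sub>i\<^sub>j\<close>.

  For the filtered statement, homogenize a syzygy of the \<open>\<rho>(P\<^sub>k)\<close> and divide it by the \<open>V\<^sub>i\<^sub>j\<close>. All
  exponents that occur have the same degree, and among those the leading one has maximal weight, so
  the division stays in the filtration, and setting \<open>h = 1\<close> gives the required representation.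
\<close>

section \<open>Leading exponents of products\<close>

text \<open>The weights may be negative, so an order adapted to the filtration need not be a
  well-order on the exponents of the Weyl algebra, and division there need not stop. After
  homogenization the degree is compared first, and only finitely many exponents with position at
  most \<open>r\<close> lie below a given degree; this is where termination comes from. Returning to
  \<open>h = 1\<close> loses nothing, because within one degree the exponent of \<open>h\<close> is
  determined by the other data and no two terms merge. The shifts \<open>m'\<close> and
  \<open>n'\<close> are chosen so that exponent \<open>\<alpha>\<close> at position \<open>k\<close>
  has the weight and the degree of \<open>lexp(P\<^sub>k) + \<alpha>\<close>. The Schreyer order
  therefore inherits adaptedness from the order it is built on. One locale,
  \<open>weyl_order\<close>, covers both orders, so leading exponents are studied once and used for
  the module containing the \<open>P\<^sub>k\<close> and for the module of their syzygies.\<close>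

lemma finite_strict_order_max:
  assumes "finite A" "A \<noteq> {}" "A \<subseteq> B" "strict_total_order_on B lt"
  shows "\<exists>m\<in>A. \<forall>a\<in>A. a = m \<or> (a, m) \<in> lt"
  using assms
proof (induction A rule: finite_ne_induct)
  case (insert x A)
  then obtain m where m: "m \<in> A" "\<And>a. a \<in> A \<Longrightarrow> a = m \<or> (a, m) \<in> lt" by auto
  have tr: "trans lt" and tot: "total_on B lt"
    using insert.prems by (auto simp: strict_total_order_on_def strict_linear_order_on_def)
  have "x \<in> B" "m \<in> B" using insert.prems m by auto
  then consider "x = m" | "(x, m) \<in> lt" | "(m, x) \<in> lt"
    using tot by (auto simp: total_on_def)
  then show ?case
  proof cases
    case 3
    then have "\<forall>a\<in>insert x A. a = x \<or> (a, x) \<in> lt" using m tr by (auto dest: transD)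
    then show ?thesis by blast
  qed (use m in auto)
qed auto

lemma vcoeff_simps [simp]:
  "vcoeff 0 e = 0" "vcoeff (P + Q) e = vcoeff P e + vcoeff Q e"
  "vcoeff (P - Q) e = vcoeff P e - vcoeff Q e"
  by (simp_all add: vcoeff_def)

lemma vcoeff_sum: "vcoeff (sum f A) e = (\<Sum>a\<in>A. vcoeff (f a) e)"
  by (induction A rule: infinite_finite_induct) (simp_all add: vcoeff_def)

lemma vcoeff_eqI: "(\<And>e. vcoeff P e = vcoeff Q e) \<Longrightarrow> P = Q"
  by (auto simp: vcoeff_def intro!: ext hweyl_eqI)

lemma vcoeff_fmod: "P \<in> fmod r \<Longrightarrow> vcoeff P e \<noteq> 0 \<Longrightarrow> e \<in> UNIV \<times> {1..r}"
  by (cases e) (auto simp: fmod_def vcoeff_def split: prod.splits intro: ccontr)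

lemma finite_vcoeff:
  assumes "P \<in> fmod r"
  shows "finite {e. vcoeff P e \<noteq> 0}"
proof (rule finite_subset)
  show "{e. vcoeff P e \<noteq> 0} \<subseteq> (\<Union>i\<in>{1..r}. {a. hcoeff (P i) a \<noteq> 0} \<times> {i})"
    using vcoeff_fmod[OF assms] by (auto simp: vcoeff_def)
qed auto

lemma fmod_closed:
  "(0 :: nat \<Rightarrow> 'a::ring_1) \<in> fmod r" "P \<in> fmod r \<Longrightarrow> Q \<in> fmod r \<Longrightarrow> P + Q \<in> fmod r"
  "P \<in> fmod r \<Longrightarrow> Q \<in> fmod r \<Longrightarrow> P - Q \<in> fmod r" "P \<in> fmod r \<Longrightarrow> a \<odot> P \<in> fmod r"
  for P Q :: "nat \<Rightarrow> 'a::ring_1"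
  by (simp_all add: fmod_def lscale_def)

section \<open>Products of normally ordered monomials\<close>

lemma hcoeff_mult:
  "hcoeff (P * Q) e = (\<Sum>a | hcoeff P a \<noteq> 0. \<Sum>b | hcoeff Q b \<noteq> 0.
     Poly_Mapping.lookup (hmono_prod a b (hcoeff P a * hcoeff Q b)) e)"
  by transfer (simp add: bilin_ext_def lookup_sum keys.rep_eq)

lemma hmono_prod_nonzeroE:
  assumes "Poly_Mapping.lookup (hmono_prod a b c) e \<noteq> 0"
  obtains \<kappa> where "\<kappa> \<in> contractions (snd a) (snd b)"
    "e = (fst a + fst b + 2 * sum \<kappa> UNIV, contr_expo (snd a) (snd b) \<kappa>)"
proof -
  from assms obtain \<kappa> where "\<kappa> \<in> contractions (snd a) (snd b)"
    "Poly_Mapping.lookup (Poly_Mapping.single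
         (fst a + fst b + 2 * (\<Sum>i\<in>UNIV. \<kappa> i), contr_expo (snd a) (snd b) \<kappa>)
         (c * of_nat (contr_coeff (snd a) (snd b) \<kappa>))) e \<noteq> 0"
    unfolding hmono_prod_def lookup_sum by (meson sum.neutral)
  then show thesis by (auto simp: lookup_single when_def split: if_splits intro!: that)
qed

text \<open>Every contraction \<kappa> other than 0 raises the exponent of \<open>h\<close> by
  \<open>2 * sum \<kappa> UNIV > 0\<close>, so only the uncontracted term, with combinatorial factor
  1, can sit at \<open>a + b\<close>.\<close>

lemma hmono_prod_lead: "Poly_Mapping.lookup (hmono_prod a b c) (a + b) = c"
proof -
  let ?t = "\<lambda>\<kappa>. Poly_Mapping.lookup (Poly_Mapping.single
         (fst a + fst b + 2 * (\<Sum>i\<in>UNIV. \<kappa> i), contr_expo (snd a) (snd b) \<kappa>)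
         (c * of_nat (contr_coeff (snd a) (snd b) \<kappa>))) (a + b)"
  have z: "?t \<kappa> = 0" if "\<kappa> \<noteq> 0" for \<kappa>
  proof -
    from that have "sum \<kappa> UNIV \<noteq> 0" by (auto simp: fun_eq_iff)
    then have "fst a + fst b + 2 * (\<Sum>i\<in>UNIV. \<kappa> i) \<noteq> fst (a + b)" by simp
    then show ?thesis by (metis fst_conv lookup_single_not_eq)
  qed
  have "Poly_Mapping.lookup (hmono_prod a b c) (a + b)
      = (\<Sum>\<kappa>\<in>contractions (snd a) (snd b). ?t \<kappa>)"
    by (simp add: hmono_prod_def lookup_sum)
  also have "\<dots> = (\<Sum>\<kappa>\<in>{0}. ?t \<kappa>)"
    by (rule sum.mono_neutral_right) (auto simp: z, auto simp: contractions_def)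
  also have "\<dots> = c" by (simp add: plus_prod_def)
  finally show ?thesis .
qed

text \<open>The subtraction in \<open>contr_expo\<close> is not truncated, since \<kappa> is bounded
  by both factors. As an equation between sums it can be fed to additive functions such as
  \<open>tdeg\<close>.\<close>

lemma contr_expo_add:
  "\<kappa> \<in> contractions \<alpha> \<beta> \<Longrightarrow> contr_expo \<alpha> \<beta> \<kappa> + case_sum \<kappa> \<kappa> = \<alpha> + \<beta>"
  by (auto simp: contractions_def contr_expo_def fun_eq_iff trans_le_add1 trans_le_add2
      split: sum.split)

lemma tdeg_add: "tdeg (\<alpha> + \<beta>) = tdeg \<alpha> + tdeg \<beta>"
  by (simp add: tdeg_def sum.distrib)

lemma hdeg_add: "hdeg (a + b) = hdeg a + hdeg b"
  by (simp add: hdeg_def tdeg_add)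

lemma tdeg_case_sum: "tdeg (case_sum \<kappa> \<kappa>) = 2 * sum \<kappa> UNIV"
proof -
  have "tdeg (case_sum \<kappa> \<kappa>) = sum (case_sum \<kappa> \<kappa>) (UNIV <+> UNIV)"
    by (simp add: tdeg_def)
  also have "\<dots> = 2 * sum \<kappa> UNIV" by (subst sum.Plus) (simp_all add: o_def)
  finally show ?thesis .
qed

lemma tdeg_xd_expo: "tdeg (xd_expo j) = 2"
  by (simp add: xd_expo_def tdeg_add) (simp add: tdeg_def unit_expo_def)

text \<open>A contraction trades \<open>x\<^sub>j\<partial>\<^sub>j\<close> for
  \<open>h\<^sup>2\<close>, which has the same total degree 2.\<close>

lemma hmono_prod_hdeg:
  assumes "Poly_Mapping.lookup (hmono_prod a b c) e \<noteq> 0"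
  shows "hdeg e = hdeg a + hdeg b"
proof -
  from assms obtain \<kappa> where k: "\<kappa> \<in> contractions (snd a) (snd b)"
    and e: "e = (fst a + fst b + 2 * sum \<kappa> UNIV, contr_expo (snd a) (snd b) \<kappa>)"
    by (rule hmono_prod_nonzeroE)
  from arg_cong[OF contr_expo_add[OF k], of tdeg] show ?thesis
    by (simp add: e hdeg_def tdeg_add tdeg_case_sum)
qed

lemma hcoeff_mult_nonzeroE:
  assumes "hcoeff (P * Q) e \<noteq> 0"
  obtains a b where "hcoeff P a \<noteq> 0" "hcoeff Q b \<noteq> 0"
    "Poly_Mapping.lookup (hmono_prod a b (hcoeff P a * hcoeff Q b)) e \<noteq> 0"
  using assms unfolding hcoeff_mult by (metis (mono_tags, lifting) mem_Collect_eq sum.neutral)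

section \<open>Shifts and joins of exponents\<close>

lemma expo_shift_Pair [simp]: "expo_shift (a, i) \<gamma> = (a + \<gamma>, i)"
  by (simp add: expo_shift_def)

lemma expo_shift_eq_iff [simp]: "expo_shift e \<gamma> = expo_shift e \<delta> \<longleftrightarrow> \<gamma> = \<delta>"
  by (simp add: expo_shift_def)

lemma expo_shift_shift: "expo_shift (expo_shift e \<gamma>) \<delta> = expo_shift e (\<gamma> + \<delta>)"
  by (simp add: expo_shift_def add.assoc)

lemma snd_expo_shift [simp]: "snd (expo_shift e \<gamma>) = snd e"
  and fst_expo_shift [simp]: "fst (expo_shift e \<gamma>) = fst e + \<gamma>"
  by (simp_all add: expo_shift_def)

text \<open>The join is a least common multiple. The quotient is a componentwise difference of
  natural numbers, exact because the common multiple dominates both \<open>a\<close> and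
  \<open>b\<close>.\<close>

lemma expo_join_dvd:
  assumes "expo_shift a \<alpha> = expo_shift b \<beta>"
  obtains \<gamma> where "expo_shift a \<alpha> = expo_shift (expo_join a b) \<gamma>"
proof -
  obtain a1 \<alpha>1 i where a: "a = ((a1, \<alpha>1), i)" by (metis surj_pair)
  obtain b1 \<beta>1 j where b: "b = ((b1, \<beta>1), j)" by (metis surj_pair)
  obtain p \<pi> where p: "\<alpha> = (p, \<pi>)" by (cases \<alpha>)
  obtain q \<theta> where q: "\<beta> = (q, \<theta>)" by (cases \<beta>)
  have eq: "a1 + p = b1 + q" "\<alpha>1 + \<pi> = \<beta>1 + \<theta>" "i = j"
    using assms by (simp_all add: a b p q)
  have "\<alpha>1 v + \<pi> v = \<beta>1 v + \<theta> v" for v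
    using fun_cong[OF eq(2), of v] by simp
  then have "\<alpha>1 v + \<pi> v = max (\<alpha>1 v) (\<beta>1 v) + (\<alpha>1 v + \<pi> v - max (\<alpha>1 v) (\<beta>1 v))" for v
    by (metis le_add1 le_add_diff_inverse max.bounded_iff)
  moreover have "a1 + p = max a1 b1 + (a1 + p - max a1 b1)" using eq by simp
  ultimately have "expo_shift a \<alpha> = expo_shift (expo_join a b)
      (a1 + p - max a1 b1, \<lambda>v. \<alpha>1 v + \<pi> v - max (\<alpha>1 v) (\<beta>1 v))"
    using eq by (simp add: a b p expo_join_def fun_eq_iff)
  then show thesis by (rule that)
qed

text \<open>What the order on the given module and its Schreyer order have in common. Compatibility
  with shifts controls only the uncontracted term of a product; \<open>h2_less\<close> is what
  controls the contracted ones.\<close>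

locale weyl_order =
  fixes r :: nat and lt :: "('n::finite hexpo \<times> nat) rel"
  assumes order: "strict_total_order_on (UNIV \<times> {1..r}) lt"
    and shift: "(a, b) \<in> lt \<Longrightarrow> (expo_shift a \<gamma>, expo_shift b \<gamma>) \<in> lt"
    and h2_less: "i \<in> {1..r} \<Longrightarrow> (((2, 0), i), ((0, xd_expo j), i)) \<in> lt"
begin

lemma lt_trans: "(a, b) \<in> lt \<Longrightarrow> (b, c) \<in> lt \<Longrightarrow> (a, c) \<in> lt"
  and lt_irrefl: "(a, a) \<notin> lt"
  and lt_total: "a \<in> UNIV \<times> {1..r} \<Longrightarrow> b \<in> UNIV \<times> {1..r} \<Longrightarrow> a = b \<or> (a, b) \<in> lt \<or> (b, a) \<in> lt"
  using order unfolding strict_total_order_on_def strict_linear_order_on_def irrefl_def total_on_def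
  by (blast dest: transD)+

lemma lt_asym: "(a, b) \<in> lt \<Longrightarrow> (b, a) \<notin> lt"
  using lt_trans lt_irrefl by blast

lemma lexp_eqI:
  assumes "vcoeff P e \<noteq> 0" "\<And>e'. vcoeff P e' \<noteq> 0 \<Longrightarrow> e' = e \<or> (e', e) \<in> lt"
  shows "lexp lt P = e"
  unfolding lexp_def using assms lt_asym by (intro the_equality) blast+

text \<open>Supports are finite, so totality alone provides a largest exponent; well-foundedness is
  left to the division.\<close>

lemma lexp_props:
  assumes "P \<in> fmod r" "P \<noteq> 0"
  shows vcoeff_lexp: "vcoeff P (lexp lt P) \<noteq> 0"
    and lexp_max: "vcoeff P e \<noteq> 0 \<Longrightarrow> e = lexp lt P \<or> (e, lexp lt P) \<in> lt"
    and lexp_range: "snd (lexp lt P) \<in> {1..r}"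
proof -
  let ?A = "{e. vcoeff P e \<noteq> 0}"
  have "?A \<noteq> {}" using assms(2) vcoeff_eqI[of P 0] by fastforce
  moreover have "?A \<subseteq> UNIV \<times> {1..r}" using vcoeff_fmod[OF assms(1)] by auto
  ultimately obtain m where m: "m \<in> ?A" "\<And>a. a \<in> ?A \<Longrightarrow> a = m \<or> (a, m) \<in> lt"
    using finite_strict_order_max[OF finite_vcoeff[OF assms(1)] _ _ order] by blast
  then have l: "lexp lt P = m" by (intro lexp_eqI) auto
  show A: "vcoeff P (lexp lt P) \<noteq> 0" using m l by simp
  show "e = lexp lt P \<or> (e, lexp lt P) \<in> lt" if "vcoeff P e \<noteq> 0"
    using m l that by simp
  show "snd (lexp lt P) \<in> {1..r}" using vcoeff_fmod[OF assms(1) A] by (simp add: mem_Times_iff)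
qed

text \<open>A contraction \<kappa> is composed of \<open>sum \<kappa> UNIV\<close> single ones. Each
  single one is a shift of \<open>h2_less\<close>, and transitivity joins them.\<close>

lemma contraction_less:
  assumes "i \<in> {1..r}" "\<kappa> \<noteq> 0"
  shows "((e + (2 * sum \<kappa> UNIV, 0), i), (e + (0, case_sum \<kappa> \<kappa>), i)) \<in> lt"
  using assms(2)
proof (induction "sum \<kappa> UNIV" arbitrary: \<kappa> e rule: less_induct)
  case less
  from less.prems obtain j where j: "\<kappa> j \<noteq> 0" by (auto simp: fun_eq_iff)
  define \<kappa>' where "\<kappa>' = \<kappa>(j := \<kappa> j - 1)"
  have s: "sum \<kappa> UNIV = Suc (sum \<kappa>' UNIV)"
    using j by (simp add: \<kappa>'_def sum.remove[of UNIV j])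
  have c: "case_sum \<kappa> \<kappa> = xd_expo j + case_sum \<kappa>' \<kappa>'"
    using j by (auto simp: \<kappa>'_def xd_expo_def unit_expo_def fun_eq_iff split: sum.split)
  have 1: "((e + (2, 0) + (0, case_sum \<kappa>' \<kappa>'), i), (e + (0, case_sum \<kappa> \<kappa>), i)) \<in> lt"
    using shift[OF h2_less[OF assms(1), of j], of "e + (0, case_sum \<kappa>' \<kappa>')"]
    by (simp add: c ac_simps plus_prod_def)
  have e: "e + (2 * sum \<kappa> UNIV, 0) = e + (2, 0) + (2 * sum \<kappa>' UNIV, 0)"
    by (simp add: s plus_prod_def)
  show ?case
  \<comment> \<open>The order is strict, so the induction hypothesis speaks of nonzero contractions
    only; if nothing is left after one contraction, the shift alone suffices.\<close>
  proof (cases "\<kappa>' = 0")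
    case True
    then have "case_sum \<kappa>' \<kappa>' = 0" "sum \<kappa>' UNIV = 0"
      by (auto simp: fun_eq_iff split: sum.split)
    then show ?thesis using 1 unfolding e by (simp add: plus_prod_def)
  next
    case False
    with less.hyps[of \<kappa>' "e + (2, 0)"] s
    have "((e + (2, 0) + (2 * sum \<kappa>' UNIV, 0), i), (e + (2, 0) + (0, case_sum \<kappa>' \<kappa>'), i)) \<in> lt"
      by simp
    then show ?thesis unfolding e using 1 lt_trans by blast
  qed
qed

lemma hmono_prod_less:
  assumes "i \<in> {1..r}" "Poly_Mapping.lookup (hmono_prod a b c) e \<noteq> 0"
  shows "e = a + b \<or> ((e, i), (a + b, i)) \<in> lt"
proof -
  from assms(2) obtain \<kappa> where k: "\<kappa> \<in> contractions (snd a) (snd b)"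
    and e: "e = (fst a + fst b + 2 * sum \<kappa> UNIV, contr_expo (snd a) (snd b) \<kappa>)"
    by (rule hmono_prod_nonzeroE)
  show ?thesis
  proof (cases "\<kappa> = 0")
    case True
    then show ?thesis by (simp add: e plus_prod_def)
  next
    case False
    from contraction_less[OF assms(1) this, of "(fst a + fst b, contr_expo (snd a) (snd b) \<kappa>)"]
    show ?thesis by (simp add: e plus_prod_def contr_expo_add[OF k])
  qed
qed

text \<open>The equality case also records that \<open>b\<close> is the leading exponent of
  \<open>P\<close>. This uniqueness is what singles out one product in the coefficient computed in
  \<open>vcoeff_lscale_lead\<close>.\<close>

lemma product_term_le:
  assumes "P \<in> fmod r" "P \<noteq> 0" "vcoeff P (b, i) \<noteq> 0"
    and "Poly_Mapping.lookup (hmono_prod \<gamma> b c) e \<noteq> 0"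
  shows "(e, i) = expo_shift (lexp lt P) \<gamma> \<and> (b, i) = lexp lt P
    \<or> ((e, i), expo_shift (lexp lt P) \<gamma>) \<in> lt"
proof -
  have i: "i \<in> {1..r}" using vcoeff_fmod[OF assms(1,3)] by simp
  have "e = \<gamma> + b \<or> ((e, i), (\<gamma> + b, i)) \<in> lt" by (rule hmono_prod_less[OF i assms(4)])
  then have 1: "(e, i) = expo_shift (b, i) \<gamma> \<or> ((e, i), expo_shift (b, i) \<gamma>) \<in> lt"
    by (simp add: add.commute)
  have "(b, i) = lexp lt P \<or> ((b, i), lexp lt P) \<in> lt"
    using lexp_max[OF assms(1-3)] .
  then show ?thesis using 1 shift[of "(b, i)" "lexp lt P" \<gamma>] lt_trans by metis
qed

lemma vcoeff_lscale_nonzeroE: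
  assumes "P \<in> fmod r" "P \<noteq> 0" "vcoeff (U \<odot> P) e \<noteq> 0"
  obtains \<gamma> where "hcoeff U \<gamma> \<noteq> 0"
    "e = expo_shift (lexp lt P) \<gamma> \<or> (e, expo_shift (lexp lt P) \<gamma>) \<in> lt"
proof -
  obtain a i where e: "e = (a, i)" by (cases e)
  from assms(3) obtain \<gamma> b where "hcoeff U \<gamma> \<noteq> 0" "hcoeff (P i) b \<noteq> 0"
    "Poly_Mapping.lookup (hmono_prod \<gamma> b (hcoeff U \<gamma> * hcoeff (P i) b)) a \<noteq> 0"
    unfolding vcoeff_def lscale_def e by (auto elim: hcoeff_mult_nonzeroE)
  then show thesis using product_term_le[OF assms(1,2), of b i \<gamma>] that[of \<gamma>]
    unfolding vcoeff_def e fst_conv snd_conv by metis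
qed

text \<open>By \<open>product_term_le\<close> and maximality of \<gamma>, exactly one pair of terms
  of \<open>U\<close> and \<open>P\<close> reaches the top exponent, so nothing can cancel there.
  Maximality is a hypothesis because \<gamma> may come from elsewhere, as from the Schreyer order in
  \<open>syzygy_critical_pair\<close>.\<close>

lemma vcoeff_lscale_lead:
  assumes "P \<in> fmod r" "P \<noteq> 0" "hcoeff U \<gamma> \<noteq> 0"
    and max: "\<And>\<delta>. hcoeff U \<delta> \<noteq> 0 \<Longrightarrow> \<delta> \<noteq> \<gamma> \<Longrightarrow>
      (expo_shift (lexp lt P) \<delta>, expo_shift (lexp lt P) \<gamma>) \<in> lt"
  shows "vcoeff (U \<odot> P) (expo_shift (lexp lt P) \<gamma>) = hcoeff U \<gamma> * lcoef lt P"
proof -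
  obtain a i where l: "lexp lt P = (a, i)" by (cases "lexp lt P")
  let ?t = "\<lambda>\<delta> b. Poly_Mapping.lookup (hmono_prod \<delta> b (hcoeff U \<delta> * hcoeff (P i) b)) (\<gamma> + a)"
  have z: "\<delta> = \<gamma> \<and> b = a" if "hcoeff U \<delta> \<noteq> 0" "hcoeff (P i) b \<noteq> 0" "?t \<delta> b \<noteq> 0" for \<delta> b
  proof -
    have "(a + \<gamma>, i) = (a + \<delta>, i) \<and> b = a \<or> ((a + \<gamma>, i), (a + \<delta>, i)) \<in> lt"
      using product_term_le[OF assms(1,2) _ that(3), of i] that(2)
      by (simp add: vcoeff_def l add.commute)
    moreover have "\<delta> = \<gamma> \<or> ((a + \<delta>, i), (a + \<gamma>, i)) \<in> lt"
      using max[OF that(1)] by (auto simp: l)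
    ultimately show ?thesis using lt_asym lt_irrefl by (metis add_left_cancel fst_conv)
  qed
  have a: "hcoeff (P i) a \<noteq> 0"
    using vcoeff_lexp[OF assms(1,2)] by (simp add: vcoeff_def l)
  have "vcoeff (U \<odot> P) (expo_shift (lexp lt P) \<gamma>)
      = (\<Sum>\<delta> | hcoeff U \<delta> \<noteq> 0. \<Sum>b | hcoeff (P i) b \<noteq> 0. ?t \<delta> b)"
    by (simp add: vcoeff_def lscale_def l hcoeff_mult add.commute)
  also have "\<dots> = (\<Sum>\<delta>\<in>{\<gamma>}. \<Sum>b | hcoeff (P i) b \<noteq> 0. ?t \<delta> b)"
    by (rule sum.mono_neutral_right) (use z assms(3) in \<open>auto intro!: sum.neutral\<close>)
  also have "\<dots> = (\<Sum>b\<in>{a}. ?t \<gamma> b)"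
  proof -
    have "(\<Sum>b | hcoeff (P i) b \<noteq> 0. ?t \<gamma> b) = (\<Sum>b\<in>{a}. ?t \<gamma> b)"
    proof (rule sum.mono_neutral_right)
      show "\<forall>b\<in>{b. hcoeff (P i) b \<noteq> 0} - {a}. ?t \<gamma> b = 0"
        using z[OF assms(3)] by blast
    qed (simp_all add: a)
    then show ?thesis by simp
  qed
  also have "\<dots> = hcoeff U \<gamma> * lcoef lt P"
    by (simp add: hmono_prod_lead lcoef_def l vcoeff_def)
  finally show ?thesis .
qed

text \<open>The top coefficient is a product of two nonzero field elements and hence survives. The
  maximality clause in the conclusion lets a bound on the lead of \<open>U \<odot> P\<close> be
  passed on to every exponent of \<open>U\<close>.\<close>

lemma lexp_lscale:
  fixes P :: "nat \<Rightarrow> ('n, 'k::field) hweyl"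
  assumes P: "P \<in> fmod r" "P \<noteq> 0" and U: "U \<noteq> 0"
  obtains \<gamma> where "hcoeff U \<gamma> \<noteq> 0" "lexp lt (U \<odot> P) = expo_shift (lexp lt P) \<gamma>"
    "lcoef lt (U \<odot> P) = hcoeff U \<gamma> * lcoef lt P" "U \<odot> P \<noteq> 0"
    "\<And>\<delta>. hcoeff U \<delta> \<noteq> 0 \<Longrightarrow> \<delta> \<noteq> \<gamma> \<Longrightarrow>
      (expo_shift (lexp lt P) \<delta>, expo_shift (lexp lt P) \<gamma>) \<in> lt"
proof -
  let ?A = "expo_shift (lexp lt P) ` {\<delta>. hcoeff U \<delta> \<noteq> 0}"
  have "\<exists>m\<in>?A. \<forall>a\<in>?A. a = m \<or> (a, m) \<in> lt"
  proof (rule finite_strict_order_max[OF _ _ _ order])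
    show "?A \<noteq> {}" using U hweyl_eqI[of U 0] by fastforce
    show "?A \<subseteq> UNIV \<times> {1..r}"
      using lexp_range[OF P] by (auto simp: expo_shift_def)
  qed simp
  then obtain \<gamma> where g: "hcoeff U \<gamma> \<noteq> 0"
    and m: "\<And>\<delta>. hcoeff U \<delta> \<noteq> 0 \<Longrightarrow> \<delta> \<noteq> \<gamma> \<Longrightarrow>
      (expo_shift (lexp lt P) \<delta>, expo_shift (lexp lt P) \<gamma>) \<in> lt"
    by fastforce
  have c: "vcoeff (U \<odot> P) (expo_shift (lexp lt P) \<gamma>) = hcoeff U \<gamma> * lcoef lt P"
    by (rule vcoeff_lscale_lead[OF P g m])
  have nz: "vcoeff (U \<odot> P) (expo_shift (lexp lt P) \<gamma>) \<noteq> 0"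
    using c g vcoeff_lexp[OF P] by (simp add: lcoef_def)
  have l: "lexp lt (U \<odot> P) = expo_shift (lexp lt P) \<gamma>"
  proof (rule lexp_eqI[OF nz])
    fix e assume "vcoeff (U \<odot> P) e \<noteq> 0"
    then obtain \<delta> where "hcoeff U \<delta> \<noteq> 0"
      "e = expo_shift (lexp lt P) \<delta> \<or> (e, expo_shift (lexp lt P) \<delta>) \<in> lt"
      using vcoeff_lscale_nonzeroE[OF P] by blast
    then show "e = expo_shift (lexp lt P) \<gamma> \<or> (e, expo_shift (lexp lt P) \<gamma>) \<in> lt"
      using m lt_trans by metis
  qed
  show thesis
  proof (rule that[OF g l _ _ m])
    show "lcoef lt (U \<odot> P) = hcoeff U \<gamma> * lcoef lt P" using c l by (simp add: lcoef_def)
    show "U \<odot> P \<noteq> 0" using nz by auto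
  qed
qed

lemma lexp_hmon_lscale:
  fixes P :: "nat \<Rightarrow> ('n, 'k::field) hweyl"
  assumes P: "P \<in> fmod r" "P \<noteq> 0" and c: "c \<noteq> 0"
  shows "lexp lt (hmon \<gamma> c \<odot> P) = expo_shift (lexp lt P) \<gamma>"
    and "lcoef lt (hmon \<gamma> c \<odot> P) = c * lcoef lt P" and "hmon \<gamma> c \<odot> P \<noteq> 0"
proof -
  have "hmon \<gamma> c \<noteq> (0 :: ('n, 'k) hweyl)"
    using c by (metis hcoeff_simps(1) hcoeff_simps(5))
  from lexp_lscale[OF P this] obtain \<delta> where d: "hcoeff (hmon \<gamma> c :: ('n, 'k) hweyl) \<delta> \<noteq> 0"
    "lexp lt (hmon \<gamma> c \<odot> P) = expo_shift (lexp lt P) \<delta>"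
    "lcoef lt (hmon \<gamma> c \<odot> P) = hcoeff (hmon \<gamma> c :: ('n, 'k) hweyl) \<delta> * lcoef lt P"
    "hmon \<gamma> c \<odot> P \<noteq> 0" by metis
  then have "\<delta> = \<gamma>" by (simp split: if_splits)
  then show "lexp lt (hmon \<gamma> c \<odot> P) = expo_shift (lexp lt P) \<gamma>"
    "lcoef lt (hmon \<gamma> c \<odot> P) = c * lcoef lt P" "hmon \<gamma> c \<odot> P \<noteq> 0" using d by simp_all
qed

end

section \<open>Homogeneous vectors and dehomogenization\<close>

text \<open>The degree is made explicit so that zero is homogeneous of every degree and the vectors
  of one degree are closed under sums and differences.\<close>

definition homogeneous_of ::
    "(nat \<Rightarrow> int) \<Rightarrow> int \<Rightarrow> (nat \<Rightarrow> ('n::finite, 'k::comm_ring_1) hweyl) \<Rightarrow> bool"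
  where "homogeneous_of n d P \<longleftrightarrow> (\<forall>e. vcoeff P e \<noteq> 0 \<longrightarrow> int (hdeg (fst e)) + n (snd e) = d)"

lemma h_homogeneous_iff: "h_homogeneous n P \<longleftrightarrow> (\<exists>d. homogeneous_of n d P)"
  by (auto simp: h_homogeneous_def homogeneous_of_def vcoeff_def)

lemma homogeneous_ofD: "homogeneous_of n d P \<Longrightarrow> vcoeff P e \<noteq> 0 \<Longrightarrow> int (hdeg (fst e)) + n (snd e) = d"
  unfolding homogeneous_of_def by blast

lemma homogeneous_of_diff:
  "homogeneous_of n d P \<Longrightarrow> homogeneous_of n d Q \<Longrightarrow> homogeneous_of n d (P - Q)"
  unfolding homogeneous_of_def
proof (intro allI impI)
  fix e
  assume "\<forall>e. vcoeff P e \<noteq> 0 \<longrightarrow> int (hdeg (fst e)) + n (snd e) = d"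
    "\<forall>e. vcoeff Q e \<noteq> 0 \<longrightarrow> int (hdeg (fst e)) + n (snd e) = d"
  moreover assume "vcoeff (P - Q) e \<noteq> 0"
  then have "vcoeff P e \<noteq> 0 \<or> vcoeff Q e \<noteq> 0" by auto
  ultimately show "int (hdeg (fst e)) + n (snd e) = d" by blast
qed

lemma homogeneous_of_sum:
  "(\<And>k. k \<in> A \<Longrightarrow> homogeneous_of n d (f k)) \<Longrightarrow> homogeneous_of n d (sum f A)"
  unfolding homogeneous_of_def vcoeff_sum by (auto elim: sum.not_neutral_contains_not_neutral)

lemma homogeneous_of_lscale:
  assumes "homogeneous_of n d P" "\<And>a. hcoeff U a \<noteq> 0 \<Longrightarrow> int (hdeg a) + d = d'"
  shows "homogeneous_of n d' (U \<odot> P)"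
  unfolding homogeneous_of_def
proof (intro allI impI)
  fix e assume "vcoeff (U \<odot> P) e \<noteq> 0"
  then obtain a b where "hcoeff U a \<noteq> 0" "hcoeff (P (snd e)) b \<noteq> 0"
    "Poly_Mapping.lookup (hmono_prod a b (hcoeff U a * hcoeff (P (snd e)) b)) (fst e) \<noteq> 0"
    by (auto simp: vcoeff_def lscale_def elim: hcoeff_mult_nonzeroE)
  then show "int (hdeg (fst e)) + n (snd e) = d'"
    using assms(2)[of a] homogeneous_ofD[OF assms(1), of "(b, snd e)"]
    by (simp add: hmono_prod_hdeg vcoeff_def)
qed

text \<open>All maxima are taken over singletons, so the degree can be read off any term, in
  particular the leading one.\<close>

lemma shifted_degree_homogeneous:
  assumes "P \<in> fmod r" "P \<noteq> 0" "homogeneous_of n d P"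
  shows "shifted_degree n r P = d"
proof -
  have t: "int (total_degree (P i)) + n i = d" if "P i \<noteq> 0" for i
  proof -
    have "\<exists>a. hcoeff (P i) a \<noteq> 0"
    proof (rule ccontr)
      assume "\<nexists>a. hcoeff (P i) a \<noteq> 0"
      then have z: "hcoeff (P i) a = 0" for a unfolding not_ex not_not by (rule spec)
      have "P i = 0" by (rule hweyl_eqI) (simp only: hcoeff_simps z)
      with that show False by simp
    qed
    then obtain a where a: "hcoeff (P i) a \<noteq> 0" by (rule exE)
    have h: "int (hdeg b) + n i = d" if "hcoeff (P i) b \<noteq> 0" for b
      using homogeneous_ofD[OF assms(3), of "(b, i)"] that by (simp add: vcoeff_def)
    have "hdeg ` {b. hcoeff (P i) b \<noteq> 0} = {hdeg a}"
    proof (rule antisym)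
      show "{hdeg a} \<subseteq> hdeg ` {b. hcoeff (P i) b \<noteq> 0}" using a by simp
      show "hdeg ` {b. hcoeff (P i) b \<noteq> 0} \<subseteq> {hdeg a}"
      proof (rule image_subsetI)
        fix b assume "b \<in> {b. hcoeff (P i) b \<noteq> 0}"
        then show "hdeg b \<in> {hdeg a}" using h[of b] h[OF a] by simp
      qed
    qed
    then show ?thesis using h[OF a] by (simp add: total_degree_def)
  qed
  obtain i where i: "P i \<noteq> 0" using assms(2) by (auto simp: fun_eq_iff)
  then have "i \<in> {1..r}" using assms(1) unfolding fmod_def by blast
  have "(\<lambda>i. int (total_degree (P i)) + n i) ` {i \<in> {1..r}. P i \<noteq> 0} = (\<lambda>i. d) ` {i \<in> {1..r}. P i \<noteq> 0}"
    using t by (intro image_cong) auto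
  also have "\<dots> = {d}" using i \<open>i \<in> {1..r}\<close> by (intro image_constant[of i]) simp
  finally show ?thesis by (simp add: shifted_degree_def)
qed

section \<open>Setting \<open>h = 1\<close>\<close>

lemma coeff_rho: "coeff (rho P) \<alpha> = (\<Sum>e | hcoeff P e \<noteq> 0. if snd e = \<alpha> then hcoeff P e else 0)"
  by transfer (simp add: dehom_def lookup_sum lookup_single when_def keys.rep_eq)

lemma coeff_rho_nonzeroE:
  assumes "coeff (rho P) \<alpha> \<noteq> 0"
  obtains l where "hcoeff P (l, \<alpha>) \<noteq> 0"
proof -
  from assms obtain e where "hcoeff P e \<noteq> 0" "snd e = \<alpha>"
    unfolding coeff_rho by (auto elim!: sum.not_neutral_contains_not_neutral split: if_splits)
  then show thesis by (intro that[of "fst e"]) auto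
qed

text \<open>In a fixed degree and position the exponent of \<open>h\<close> is determined by the
  rest of the exponent, so distinct terms keep distinct exponents when \<open>h\<close> becomes
  1.\<close>

lemma coeff_rho_homogeneous:
  assumes "homogeneous_of n d P" "hcoeff (P i) e \<noteq> 0"
  shows "coeff (rho (P i)) (snd e) = hcoeff (P i) e"
proof -
  have "e' = e" if "hcoeff (P i) e' \<noteq> 0" "snd e' = snd e" for e'
    using homogeneous_ofD[OF assms(1), of "(e, i)"] homogeneous_ofD[OF assms(1), of "(e', i)"]
      that assms(2) by (auto simp: vcoeff_def hdeg_def prod_eq_iff)
  then have "coeff (rho (P i)) (snd e)
      = (\<Sum>e' | hcoeff (P i) e' \<noteq> 0. if e' = e then hcoeff (P i) e' else 0)"
    unfolding coeff_rho by (intro sum.cong) auto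
  then show ?thesis using assms(2) by simp
qed

lemma vrho_simps:
  "vrho 0 = 0" "vrho (P + Q) = vrho P + vrho Q" "vrho (U \<odot> P) = rho U \<odot> vrho P"
  by (simp_all add: vrho_def lscale_def fun_eq_iff)

lemma vrho_sum: "vrho (sum f A) = (\<Sum>a\<in>A. vrho (f a))"
proof (induction A rule: infinite_finite_induct)
  case (insert a A)
  then show ?case by (metis sum.insert vrho_simps(2))
qed (metis sum.infinite sum.empty vrho_simps(1))+

text \<open>This injectivity is what lifts a relation between the \<open>\<rho>(P\<^sub>k)\<close>
  to one between the \<open>P\<^sub>k\<close>.\<close>

lemma vrho_homogeneous_eq_0:
  fixes P :: "nat \<Rightarrow> ('n::finite, 'k::comm_ring_1) hweyl"
  assumes "homogeneous_of n d P" "vrho P = 0"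
  shows "P = 0"
proof (rule vcoeff_eqI)
  fix e :: "'n hexpo \<times> nat"
  have "rho (P (snd e)) = 0" using fun_cong[OF assms(2), of "snd e"] by (simp add: vrho_def)
  then show "vcoeff P e = vcoeff 0 e"
    using coeff_rho_homogeneous[OF assms(1), of "snd e" "fst e"] by (auto simp: vcoeff_def)
qed

section \<open>Submodules, filtrations and homogenization of vectors\<close>

lemma lscale_simps:
  "(0 :: 'a::ring_1) \<odot> P = 0" "a \<odot> (0 :: nat \<Rightarrow> 'a) = 0"
  "(a + b) \<odot> P = a \<odot> P + b \<odot> P" "(a - b) \<odot> P = a \<odot> P - b \<odot> P"
  "(- a) \<odot> P = - (a \<odot> P)"
  for P :: "nat \<Rightarrow> 'a::ring_1"
  by (simp_all add: lscale_def fun_eq_iff algebra_simps)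

lemma left_submodule_diff:
  assumes "left_submodule r N" "P \<in> N" "Q \<in> N"
  shows "P - Q \<in> N"
proof -
  have "P + (- 1) \<odot> Q \<in> N" using assms by (simp add: left_submodule_def)
  moreover have "P + (- 1) \<odot> Q = P - Q" by (simp add: lscale_def fun_eq_iff)
  ultimately show ?thesis by simp
qed

lemma module_filt_closed:
  fixes P Q :: "nat \<Rightarrow> ('n::finite, 'k::comm_ring_1) weyl"
  shows "(0 :: nat \<Rightarrow> ('n, 'k) weyl) \<in> module_filt w m r \<nu>"
    and "P \<in> module_filt w m r \<nu> \<Longrightarrow> Q \<in> module_filt w m r \<nu> \<Longrightarrow> P + Q \<in> module_filt w m r \<nu>"
proof -
  show "(0 :: nat \<Rightarrow> ('n, 'k) weyl) \<in> module_filt w m r \<nu>" by (simp add: module_filt_def fmod_def weyl_filt_def)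
  assume "P \<in> module_filt w m r \<nu>" "Q \<in> module_filt w m r \<nu>"
  moreover have "A + B \<in> weyl_filt w k" if "A \<in> weyl_filt w k" "B \<in> weyl_filt w k"
    for A B :: "('n, 'k) weyl" and k
    using that unfolding weyl_filt_def mem_Collect_eq coeff_simps by (metis add.right_neutral)
  ultimately show "P + Q \<in> module_filt w m r \<nu>"
    by (simp add: module_filt_def fmod_def)
qed

text \<open>The weight ignores \<open>h\<close>, and cancellation under \<open>rho\<close> can only
  remove exponents.\<close>

lemma vrho_module_filt:
  assumes "P \<in> fmod r"
    and "\<And>e. vcoeff P e \<noteq> 0 \<Longrightarrow> weight w (snd (fst e)) + m (snd e) \<le> \<nu>"
  shows "vrho P \<in> module_filt w m r \<nu>"
proof -
  have "weight w \<alpha> \<le> \<nu> - m i" if "coeff (rho (P i)) \<alpha> \<noteq> 0" for i \<alpha>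
  proof -
    from that obtain l where "hcoeff (P i) (l, \<alpha>) \<noteq> 0" by (rule coeff_rho_nonzeroE)
    with assms(2)[of "((l, \<alpha>), i)"] show ?thesis by (simp add: vcoeff_def)
  qed
  then show ?thesis using assms(1) by (simp add: module_filt_def fmod_def vrho_def weyl_filt_def)
qed

lemma weight_add: "weight w (\<alpha> + \<beta>) = weight w \<alpha> + weight w \<beta>"
  by (simp add: weight_def sum.distrib algebra_simps)

text \<open>Any sufficiently large degree \<open>d\<close> will do, which covers the zero vector
  without a separate case. The last conclusion carries weight bounds from \<open>R\<close> over to
  \<open>X\<close>.\<close>

lemma homogenization_exists:
  fixes R :: "nat \<Rightarrow> ('n::finite, 'k::comm_ring_1) weyl"
  assumes "R \<in> fmod s"
  obtains d X where "X \<in> fmod s" "homogeneous_of n d X" "vrho X = R"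
    "\<And>i l \<alpha>. hcoeff (X i) (l, \<alpha>) \<noteq> 0 \<Longrightarrow> coeff (R i) \<alpha> \<noteq> 0"
proof -
  let ?D = "(\<Union>i\<in>{1..s}. (\<lambda>\<alpha>. int (tdeg \<alpha>) + n i) ` {\<alpha>. coeff (R i) \<alpha> \<noteq> 0})"
  obtain d where d: "\<And>x. x \<in> ?D \<Longrightarrow> x \<le> d"
    using bdd_above_finite[of ?D] by (auto simp: bdd_above_def)
  \<comment> \<open>On the support of \<open>R\<close> the bound \<open>d\<close> makes the argument
    of \<open>nat\<close> nonnegative, so the exponent of \<open>h\<close> fills the degree up to
    exactly \<open>d\<close>.\<close>
  define X where "X i = (\<Sum>\<alpha> | coeff (R i) \<alpha> \<noteq> 0.
    hmon (nat (d - int (tdeg \<alpha>) - n i), \<alpha>) (coeff (R i) \<alpha>))" for i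
  have hc: "hcoeff (X i) (l, \<alpha>) = (if l = nat (d - int (tdeg \<alpha>) - n i) then coeff (R i) \<alpha> else 0)"
    for i l \<alpha>
  proof -
    have "hcoeff (X i) (l, \<alpha>) = (\<Sum>\<beta> | coeff (R i) \<beta> \<noteq> 0. if \<beta> = \<alpha>
        then if l = nat (d - int (tdeg \<alpha>) - n i) then coeff (R i) \<alpha> else 0 else 0)"
      unfolding X_def hcoeff_sum by (intro sum.cong) auto
    then show ?thesis by simp
  qed
  have 0: "R i = 0" if "i \<notin> {1..s}" for i using assms that by (simp add: fmod_def)
  show thesis
  proof (rule that)
    show "X \<in> fmod s" using 0 by (simp add: fmod_def X_def)
    show "homogeneous_of n d X"
      unfolding homogeneous_of_def
    proof (intro allI impI)
      fix e assume "vcoeff X e \<noteq> 0"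
      moreover obtain l \<alpha> i where e: "e = ((l, \<alpha>), i)" by (metis surj_pair)
      ultimately have c: "coeff (R i) \<alpha> \<noteq> 0" and l: "l = nat (d - int (tdeg \<alpha>) - n i)"
        by (auto simp: vcoeff_def hc split: if_splits)
      have "i \<in> {1..s}" using c 0 by fastforce
      with c have "int (tdeg \<alpha>) + n i \<le> d" by (intro d) auto
      then show "int (hdeg (fst e)) + n (snd e) = d" by (simp add: e hdeg_def l)
    qed
    show "vrho X = R"
    proof
      fix i
      have "rho (sum f A) = (\<Sum>a\<in>A. rho (f a))" for A and f :: "'n expo \<Rightarrow> ('n, 'k) hweyl"
        by (induction A rule: infinite_finite_induct) simp_all
      then show "vrho X i = R i" by (simp add: vrho_def X_def flip: weyl_expand)
    qed
  qed (simp add: hc split: if_splits)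
qed

section \<open>Adapted orders and division\<close>

lemma finite_hdeg_le: "finite {a :: 'n::finite hexpo. hdeg a \<le> K}"
proof (rule finite_subset)
  have "\<alpha> v \<le> tdeg \<alpha>" for \<alpha> :: "'n expo" and v
    unfolding tdeg_def by (rule member_le_sum) auto
  then show "{a :: 'n hexpo. hdeg a \<le> K} \<subseteq> {..K} \<times> {\<alpha>. \<alpha> \<le> (\<lambda>_. K)}"
    by (fastforce simp: hdeg_def le_fun_def intro: order_trans)
qed (simp add: finite_le_fun)

lemma h_order_iff:
  "(a, b) \<in> h_order n r prec \<longleftrightarrow> snd a \<in> {1..r} \<and> snd b \<in> {1..r} \<and>
    (int (hdeg (fst a)) + n (snd a) < int (hdeg (fst b)) + n (snd b) \<or>
     int (hdeg (fst a)) + n (snd a) = int (hdeg (fst b)) + n (snd b) \<and>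
       ((snd (fst a), snd a), (snd (fst b), snd b)) \<in> prec)"
  by (cases a; cases b; cases "fst a"; cases "fst b") (simp add: h_order_def)

lemma h_order_weyl_order:
  fixes prec :: "('n::finite expo \<times> nat) rel"
  assumes "monomial_order r prec" "adapted w m r prec"
  shows "weyl_order r (h_order n r prec)"
proof
  have tr: "\<And>a b c. (a, b) \<in> prec \<Longrightarrow> (b, c) \<in> prec \<Longrightarrow> (a, c) \<in> prec"
    and ir: "\<And>a. (a, a) \<notin> prec"
    and tot: "\<And>a b. a \<in> UNIV \<times> {1..r} \<Longrightarrow> b \<in> UNIV \<times> {1..r} \<Longrightarrow> a \<noteq> b \<Longrightarrow> (a, b) \<in> prec \<or> (b, a) \<in> prec"
    using assms(1) unfolding monomial_order_def strict_total_order_on_def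
      strict_linear_order_on_def irrefl_def total_on_def by (blast dest: transD)+
  have "trans (h_order n r prec)"
    by (rule transI) (auto simp: h_order_def dest: tr)
  moreover have "irrefl (h_order n r prec)"
    by (auto simp: h_order_def irrefl_def ir)
  moreover have "total_on (UNIV \<times> {1..r}) (h_order n r prec)"
  proof (rule total_onI)
    fix e e' :: "'n hexpo \<times> nat" assume "e \<in> UNIV \<times> {1..r}" "e' \<in> UNIV \<times> {1..r}" "e \<noteq> e'"
    moreover obtain k \<alpha> i where e: "e = ((k, \<alpha>), i)" by (metis surj_pair)
    moreover obtain l \<beta> j where e': "e' = ((l, \<beta>), j)" by (metis surj_pair)
    ultimately have ij: "i \<in> {1..r}" "j \<in> {1..r}" "(k, \<alpha>, i) \<noteq> (l, \<beta>, j)" by auto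
    show "(e, e') \<in> h_order n r prec \<or> (e', e) \<in> h_order n r prec"
    \<comment> \<open>In equal degrees, \<open>(\<alpha>, i) = (\<beta>, j)\<close> would force the
      exponents of \<open>h\<close> to agree as well, so \<open>prec\<close> separates the
      two.\<close>
    proof (cases "int (hdeg (k, \<alpha>)) + n i = int (hdeg (l, \<beta>)) + n j")
      case True
      then have "(\<alpha>, i) \<noteq> (\<beta>, j)" using ij(3) by (auto simp: hdeg_def)
      then have "((\<alpha>, i), (\<beta>, j)) \<in> prec \<or> ((\<beta>, j), (\<alpha>, i)) \<in> prec" using ij by (intro tot) auto
      then show ?thesis using True ij(1,2) by (auto simp: h_order_def e e')
    next
      case False
      then show ?thesis using ij(1,2) by (auto simp: h_order_def e e')
    qed
  qed
  ultimately show "strict_total_order_on (UNIV \<times> {1..r}) (h_order n r prec)"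
    by (auto simp: strict_total_order_on_def strict_linear_order_on_def h_order_def)
  have "\<And>\<alpha> \<beta> \<gamma> i j. ((\<alpha>, i), (\<beta>, j)) \<in> prec \<Longrightarrow> ((\<alpha> + \<gamma>, i), (\<beta> + \<gamma>, j)) \<in> prec"
    using assms(1) unfolding monomial_order_def by blast
  then show "(expo_shift a \<gamma>, expo_shift b \<gamma>) \<in> h_order n r prec" if "(a, b) \<in> h_order n r prec" for a b \<gamma>
    using that unfolding h_order_iff fst_expo_shift snd_expo_shift hdeg_add snd_add by auto
  show "(((2, 0), i), ((0, xd_expo j), i)) \<in> h_order n r prec" if "i \<in> {1..r}" for i j
  proof -
    \<comment> \<open>Both exponents have degree 2, so the comparison falls to \<open>prec\<close>,
      and the second clause of \<open>adapted\<close> decides it.\<close>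
    have "tdeg (0 :: 'n expo) = 0" by (simp add: tdeg_def)
    then show ?thesis
      using that assms(2) by (simp add: h_order_iff hdeg_def tdeg_xd_expo adapted_def)
  qed
qed

text \<open>Each exponent has finitely many predecessors: their positions lie in
  \<open>{1..r}\<close> and their degrees are bounded. By transitivity and irreflexivity the number
  of predecessors strictly increases along the order, and so serves as a measure whether or not
  \<open>prec\<close> is well-founded.\<close>

lemma wf_h_order:
  fixes n :: "nat \<Rightarrow> int" and prec :: "('n::finite expo \<times> nat) rel"
  assumes "weyl_order r (h_order n r prec)"
  shows "wf (h_order n r prec)"
proof -
  interpret weyl_order r "h_order n r prec" by fact
  let ?B = "\<lambda>e. {e'. (e', e) \<in> h_order n r prec}"
  have fin: "finite (?B e)" for e
  proof (rule finite_subset)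
    show "?B e \<subseteq> (\<Union>i\<in>{1..r}. {a. hdeg a \<le> nat (int (hdeg (fst e)) + n (snd e) - n i)} \<times> {i})"
      by (auto simp: h_order_def)
  qed (simp add: finite_hdeg_le)
  have "h_order n r prec \<subseteq> measure (\<lambda>e. card (?B e))"
  proof (clarsimp simp del: split_paired_All)
    fix a b c x y z assume l: "(((a, b), c), ((x, y), z)) \<in> h_order n r prec"
    show "card (?B ((a, b), c)) < card (?B ((x, y), z))"
      by (rule psubset_card_mono[OF fin]) (use l lt_trans lt_irrefl in blast)
  qed
  then show ?thesis by (rule wf_subset[OF wf_measure])
qed

lemma h_adaptedD:
  assumes "h_adapted w m n s lt" "i \<in> {1..s}" "j \<in> {1..s}"
    and "int (hdeg a) + n i = int (hdeg b) + n j"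
    and "weight w (snd a) + m i < weight w (snd b) + m j"
  shows "((a, i), (b, j)) \<in> lt"
  using assms unfolding h_adapted_def by blast

lemma h_order_adapted:
  assumes "monomial_order r prec" "adapted w m r prec"
  shows "h_adapted w m n r (h_order n r prec)"
  using assms(2) weyl_order.h2_less[OF h_order_weyl_order[OF assms]]
  by (auto simp: h_adapted_def h_order_def adapted_def)

section \<open>Weights of leading exponents and division\<close>

context weyl_order
begin

text \<open>Homogeneity places all exponents in one degree, which is where \<open>h_adapted\<close>
  applies: a heavier exponent there would be larger than the leading one.\<close>

lemma weight_le_lexp:
  assumes "h_adapted w m n r lt" "P \<in> fmod r" "homogeneous_of n d P" "vcoeff P e \<noteq> 0"
  shows "weight w (snd (fst e)) + m (snd e)
    \<le> weight w (snd (fst (lexp lt P))) + m (snd (lexp lt P))"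
proof (rule ccontr)
  assume "\<not> ?thesis"
  moreover have P: "P \<noteq> 0" using assms(4) by auto
  have "int (hdeg (fst e)) + n (snd e) = int (hdeg (fst (lexp lt P))) + n (snd (lexp lt P))"
    using homogeneous_ofD[OF assms(3)] assms(4) vcoeff_lexp[OF assms(2) P] by simp
  moreover have "snd e \<in> {1..r}" using vcoeff_fmod[OF assms(2,4)] by (simp add: mem_Times_iff)
  ultimately have "((fst (lexp lt P), snd (lexp lt P)), (fst e, snd e)) \<in> lt"
    using assms(1) lexp_range[OF assms(2) P] unfolding h_adapted_def by (metis not_le)
  then show False
    using lexp_max[OF assms(2) P assms(4)] lt_asym lt_irrefl by (metis prod.collapse)
qed

text \<open>The leading exponent is the heaviest, which bounds the order from above; its term
  survives \<open>h = 1\<close>, which bounds it from below. So \<open>m'\<close> can be read off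
  the leading exponents of the \<open>P\<^sub>k\<close>.\<close>

lemma filt_ord_vrho:
  assumes "h_adapted w m n r lt" "P \<in> fmod r" "P \<noteq> 0" "homogeneous_of n d P"
  shows "filt_ord w m r (vrho P) = weight w (snd (fst (lexp lt P))) + m (snd (lexp lt P))"
  unfolding filt_ord_def
proof (rule Least_equality)
  show "vrho P \<in> module_filt w m r (weight w (snd (fst (lexp lt P))) + m (snd (lexp lt P)))"
    using weight_le_lexp[OF assms(1,2,4)] by (rule vrho_module_filt[OF assms(2)])
next
  fix k assume k: "vrho P \<in> module_filt w m r k"
  obtain e i where l: "lexp lt P = (e, i)" by (cases "lexp lt P")
  have "hcoeff (P i) e \<noteq> 0" and i: "i \<in> {1..r}"
    using vcoeff_lexp[OF assms(2,3)] lexp_range[OF assms(2,3)] by (simp_all add: l vcoeff_def)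
  then have c: "coeff (rho (P i)) (snd e) \<noteq> 0" using coeff_rho_homogeneous[OF assms(4)] by simp
  have "rho (P i) \<in> weyl_filt w (k - m i)" using k i by (simp add: module_filt_def vrho_def)
  with c have "weight w (snd e) \<le> k - m i" unfolding weyl_filt_def by blast
  then show "weight w (snd (fst (lexp lt P))) + m (snd (lexp lt P)) \<le> k"
    by (simp add: l)
qed

text \<open>Each reduction subtracts a monomial multiple of some \<open>V p\<close> with the same
  leading term as \<open>X\<close>, and keeps the degree and the weight bound; \<open>wf lt\<close>
  makes this stop. The family is indexed by \<open>I\<close> because each index is to receive a
  quotient, even if \<open>V\<close> takes a value twice.\<close>

lemma groebner_division:
  fixes V :: "'i \<Rightarrow> nat \<Rightarrow> ('n, 'k::field) hweyl"
  assumes wf: "wf lt" and ad: "h_adapted w m n r lt" and fin: "finite I"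
    and gb: "groebner_basis r lt M (V ` I)"
    and hom: "\<And>p. p \<in> I \<Longrightarrow> h_homogeneous n (V p)"
    and X: "X \<in> M" "homogeneous_of n d X"
      "\<And>e. vcoeff X e \<noteq> 0 \<Longrightarrow> weight w (snd (fst e)) + m (snd e) \<le> \<nu>"
  shows "\<exists>Q. vrho X = (\<Sum>p\<in>I. Q p \<odot> vrho (V p)) \<and>
    (\<forall>p\<in>I. Q p \<odot> vrho (V p) \<in> module_filt w m r \<nu>)"
  using wf X
proof (induction "lexp lt X" arbitrary: X rule: wf_induct_rule)
  case (less X)
  have M: "left_submodule r M" "V ` I \<subseteq> M" "M \<subseteq> fmod r"
    using gb by (auto simp: groebner_basis_def left_submodule_def)
  show ?case
  proof (cases "X = 0")
    case True
    have "(\<Sum>p\<in>I. 0 \<odot> vrho (V p)) = 0" by (rule sum.neutral) (simp add: lscale_simps)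
    then show ?thesis
      using True by (intro exI[of _ "\<lambda>_. 0"]) (simp add: lscale_simps vrho_simps module_filt_closed)
  next
    case False
    have Xf: "X \<in> fmod r" using less.prems M by auto
    from gb less.prems(1) False obtain p \<gamma> where p: "p \<in> I" "V p \<noteq> 0"
      and l: "lexp lt X = expo_shift (lexp lt (V p)) \<gamma>"
      unfolding groebner_basis_def by blast
    have Vf: "V p \<in> fmod r" using p M by auto
    define c where "c = lcoef lt X / lcoef lt (V p)"
    have c: "c \<noteq> 0" "c * lcoef lt (V p) = lcoef lt X"
      using vcoeff_lexp[OF Xf False] vcoeff_lexp[OF Vf p(2)] by (simp_all add: c_def lcoef_def)
    define Y where "Y = hmon \<gamma> c \<odot> V p"
    have Yf: "Y \<in> fmod r" using Vf by (simp add: Y_def fmod_closed)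
    have lY: "lexp lt Y = lexp lt X" "lcoef lt Y = lcoef lt X" "Y \<noteq> 0"
      using lexp_hmon_lscale[OF Vf p(2) c(1), of \<gamma>] c(2) l by (simp_all add: Y_def)
    obtain d' where d': "homogeneous_of n d' (V p)" using hom[OF p(1)] h_homogeneous_iff by blast
    have "homogeneous_of n (int (hdeg \<gamma>) + d') Y"
      unfolding Y_def by (rule homogeneous_of_lscale[OF d']) (simp split: if_splits)
    \<comment> \<open>\<open>Y\<close> shares its leading exponent with \<open>X\<close>, hence also
      its degree.\<close>
    moreover from this have "int (hdeg \<gamma>) + d' = d"
      using homogeneous_ofD[OF less.prems(2) vcoeff_lexp[OF Xf False]]
        homogeneous_ofD[OF _ vcoeff_lexp[OF Yf lY(3)]] by (simp add: lY(1))
    ultimately have Yh: "homogeneous_of n d Y" by simp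
    \<comment> \<open>No exponent of \<open>Y\<close> is heavier than its leading one, and that one
      occurs in \<open>X\<close>.\<close>
    have Yw: "weight w (snd (fst e)) + m (snd e) \<le> \<nu>" if "vcoeff Y e \<noteq> 0" for e
      using weight_le_lexp[OF ad Yf Yh that] less.prems(3)[OF vcoeff_lexp[OF Xf False]]
      by (simp add: lY(1))
    have YM: "Y \<in> M" using M p by (auto simp: Y_def left_submodule_def)
    have X'M: "X - Y \<in> M" using M(1) less.prems(1) YM by (rule left_submodule_diff)
    have X'h: "homogeneous_of n d (X - Y)" using less.prems(2) Yh by (rule homogeneous_of_diff)
    have X'w: "weight w (snd (fst e)) + m (snd e) \<le> \<nu>" if "vcoeff (X - Y) e \<noteq> 0" for e
      using that less.prems(3)[of e] Yw[of e] by (cases "vcoeff X e = 0") auto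
    have "\<exists>Q. vrho (X - Y) = (\<Sum>p\<in>I. Q p \<odot> vrho (V p)) \<and>
      (\<forall>p\<in>I. Q p \<odot> vrho (V p) \<in> module_filt w m r \<nu>)"
    proof (cases "X - Y = 0")
      case True
      have "(\<Sum>p\<in>I. 0 \<odot> vrho (V p)) = 0" by (rule sum.neutral) (simp add: lscale_simps)
      then show ?thesis using True
        by (intro exI[of _ "\<lambda>_. 0"]) (simp add: lscale_simps vrho_simps module_filt_closed)
    next
      case nz: False
      have X'f: "X - Y \<in> fmod r" using Xf Yf by (rule fmod_closed)
      let ?e = "lexp lt (X - Y)"
      have nz': "vcoeff (X - Y) ?e \<noteq> 0" by (rule vcoeff_lexp[OF X'f nz])
      \<comment> \<open>The constant \<open>c\<close> was chosen to cancel the coefficient at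
        \<open>lexp lt X\<close>, so the lead must drop.\<close>
      then have "?e \<noteq> lexp lt X" using lY by (auto simp: lcoef_def)
      moreover have "vcoeff X ?e \<noteq> 0 \<or> vcoeff Y ?e \<noteq> 0" using nz' by auto
      ultimately have "(?e, lexp lt X) \<in> lt"
        using lexp_max[OF Xf False] lexp_max[OF Yf lY(3)] lY(1) by metis
      then show ?thesis using less.hyps X'M X'h X'w by blast
    qed
    then obtain Q where Q: "vrho (X - Y) = (\<Sum>p\<in>I. Q p \<odot> vrho (V p))"
      "\<And>p. p \<in> I \<Longrightarrow> Q p \<odot> vrho (V p) \<in> module_filt w m r \<nu>" by blast
    have vY: "rho (hmon \<gamma> c) \<odot> vrho (V p) = vrho Y" by (simp only: Y_def vrho_simps)
    have Ym: "vrho Y \<in> module_filt w m r \<nu>" using Yw by (rule vrho_module_filt[OF Yf])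
    \<comment> \<open>The index \<open>p\<close> may have been chosen in other reductions too, so
      the new monomial is added to its quotient; the filtration is closed under this
      addition.\<close>
    let ?Q = "Q(p := Q p + rho (hmon \<gamma> c))"
    have "X = (X - Y) + Y" by simp
    then have "vrho X = vrho (X - Y) + vrho Y" by (metis vrho_simps(2))
    also have "\<dots> = (\<Sum>q\<in>I. ?Q q \<odot> vrho (V q))"
      unfolding Q(1) sum.remove[OF fin p(1)] fun_upd_same lscale_simps vY
      by (simp add: fun_eq_iff)
    finally have "vrho X = (\<Sum>q\<in>I. ?Q q \<odot> vrho (V q))" .
    moreover have "?Q q \<odot> vrho (V q) \<in> module_filt w m r \<nu>" if "q \<in> I" for q
    proof (cases "q = p")
      case True
      then show ?thesis
        using module_filt_closed(2)[OF Q(2)[OF p(1)] Ym] by (simp only: fun_upd_same lscale_simps vY)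
    next
      case False
      then show ?thesis using Q(2)[OF that] by simp
    qed
    ultimately show ?thesis by blast
  qed
qed

end

section \<open>The Schreyer order and syzygies\<close>

context weyl_order
begin

lemma schreyer_iff:
  "(a, b) \<in> schreyer_order lt s P \<longleftrightarrow> snd a \<in> {1..s} \<and> snd b \<in> {1..s} \<and>
    ((expo_shift (lexp lt (P (snd a))) (fst a), expo_shift (lexp lt (P (snd b))) (fst b)) \<in> lt \<or>
     expo_shift (lexp lt (P (snd a))) (fst a) = expo_shift (lexp lt (P (snd b))) (fst b) \<and> snd a > snd b)"
  by (cases a; cases b) (auto simp: schreyer_order_def)

lemma schreyer_weyl_order:
  assumes P: "\<And>k. k \<in> {1..s} \<Longrightarrow> P k \<in> fmod r" "\<And>k. k \<in> {1..s} \<Longrightarrow> P k \<noteq> 0"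
  shows "weyl_order s (schreyer_order lt s P)"
proof
  let ?L = "\<lambda>e. expo_shift (lexp lt (P (snd e))) (fst e)"
  have "trans (schreyer_order lt s P)"
  proof (rule transI)
    fix a b c assume "(a, b) \<in> schreyer_order lt s P" "(b, c) \<in> schreyer_order lt s P"
    then show "(a, c) \<in> schreyer_order lt s P"
      unfolding schreyer_iff using lt_trans[of "?L a" "?L b" "?L c"] by auto
  qed
  moreover have "irrefl (schreyer_order lt s P)"
    unfolding irrefl_def schreyer_iff using lt_irrefl by blast
  moreover have "total_on (UNIV \<times> {1..s}) (schreyer_order lt s P)"
  proof (rule total_onI)
    fix a b :: "'n hexpo \<times> nat"
    assume ab: "a \<in> UNIV \<times> {1..s}" "b \<in> UNIV \<times> {1..s}" "a \<noteq> b"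
    then have k: "snd a \<in> {1..s}" "snd b \<in> {1..s}" by (auto simp: mem_Times_iff)
    have "?L a = ?L b \<or> (?L a, ?L b) \<in> lt \<or> (?L b, ?L a) \<in> lt"
      using lexp_range[OF P(1)[OF k(1)] P(2)[OF k(1)]] lexp_range[OF P(1)[OF k(2)] P(2)[OF k(2)]]
      by (intro lt_total) (auto simp: mem_Times_iff)
    \<comment> \<open>Shifting a fixed exponent is injective, so a tie between distinct arguments
      occurs only at different positions, where the index breaks it.\<close>
    moreover have "snd a \<noteq> snd b" if "?L a = ?L b"
      using that ab(3) by (metis expo_shift_eq_iff prod_eqI)
    ultimately show "(a, b) \<in> schreyer_order lt s P \<or> (b, a) \<in> schreyer_order lt s P"
      unfolding schreyer_iff using k by (metis nat_neq_iff)
  qed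
  moreover have "schreyer_order lt s P \<subseteq> (UNIV \<times> {1..s}) \<times> (UNIV \<times> {1..s})"
    unfolding schreyer_order_def by blast
  ultimately show "strict_total_order_on (UNIV \<times> {1..s}) (schreyer_order lt s P)"
    by (simp add: strict_total_order_on_def strict_linear_order_on_def)
  show "(expo_shift a \<gamma>, expo_shift b \<gamma>) \<in> schreyer_order lt s P"
    if "(a, b) \<in> schreyer_order lt s P" for a b \<gamma>
  proof -
    have "?L (expo_shift e \<gamma>) = expo_shift (?L e) \<gamma>" for e by (simp add: expo_shift_shift)
    then show ?thesis using that shift[of "?L a" "?L b" \<gamma>] unfolding schreyer_iff by auto
  qed
  show "(((2, 0), i), ((0, xd_expo j), i)) \<in> schreyer_order lt s P" if i: "i \<in> {1..s}" for i j
  proof -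
    have "snd (lexp lt (P i)) \<in> {1..r}" using P i by (intro lexp_range) auto
    from shift[OF h2_less[OF this, of j], of "fst (lexp lt (P i))"] i show ?thesis
      unfolding schreyer_iff by (simp add: expo_shift_def add.commute)
  qed
qed

text \<open>The order is a lexicographic product. In a tie the larger index is the smaller element,
  hence the second component \<open>s - snd e\<close>; it drops strictly because positions do not
  exceed \<open>s\<close>.\<close>

lemma wf_schreyer_order:
  assumes "wf lt"
  shows "wf (schreyer_order lt s P)"
proof (rule wf_subset)
  let ?f = "\<lambda>e. (expo_shift (lexp lt (P (snd e))) (fst e), s - snd e)"
  show "wf (inv_image (lt <*lex*> less_than) ?f)" using assms by auto
  show "schreyer_order lt s P \<subseteq> inv_image (lt <*lex*> less_than) ?f"
  proof
    fix x assume "x \<in> schreyer_order lt s P"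
    then show "x \<in> inv_image (lt <*lex*> less_than) ?f"
      unfolding inv_image_def in_lex_prod mem_Collect_eq
      by (cases x) (auto simp: schreyer_iff simp del: split_paired_All)
  qed
qed

text \<open>The shifts are the weight and degree of the leading exponents, so both conditions on
  \<open>(a, i)\<close> become conditions on \<open>lexp(P\<^sub>i) + a\<close>, and adaptedness of
  \<open>lt\<close> applies there.\<close>

lemma schreyer_adapted:
  assumes P: "\<And>k. k \<in> {1..s} \<Longrightarrow> P k \<in> fmod r" "\<And>k. k \<in> {1..s} \<Longrightarrow> P k \<noteq> 0"
    and ad: "h_adapted w m n r lt"
    and hom: "\<And>k. k \<in> {1..s} \<Longrightarrow> h_homogeneous n (P k)"
  shows "h_adapted w (\<lambda>k. filt_ord w m r (vrho (P k))) (\<lambda>k. shifted_degree n r (P k)) s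
    (schreyer_order lt s P)"
  unfolding h_adapted_def
proof (intro conjI allI ballI impI)
  show "(((2, 0), i), ((0, xd_expo j), i)) \<in> schreyer_order lt s P" if "i \<in> {1..s}" for i j
    using weyl_order.h2_less[OF schreyer_weyl_order[of s P]] P that by blast
next
  fix a b :: "'n hexpo" and i j
  assume i: "i \<in> {1..s}" and j: "j \<in> {1..s}"
    and d: "int (hdeg a) + shifted_degree n r (P i) = int (hdeg b) + shifted_degree n r (P j)"
    and w: "weight w (snd a) + filt_ord w m r (vrho (P i)) < weight w (snd b) + filt_ord w m r (vrho (P j))"
  have f: "filt_ord w m r (vrho (P k)) = weight w (snd (fst (lexp lt (P k)))) + m (snd (lexp lt (P k)))"
    "shifted_degree n r (P k) = int (hdeg (fst (lexp lt (P k)))) + n (snd (lexp lt (P k)))"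
    "snd (lexp lt (P k)) \<in> {1..r}"
    if k: "k \<in> {1..s}" for k
  proof -
    obtain d where d: "homogeneous_of n d (P k)" using hom[OF k] h_homogeneous_iff by blast
    show "filt_ord w m r (vrho (P k)) = weight w (snd (fst (lexp lt (P k)))) + m (snd (lexp lt (P k)))"
      by (rule filt_ord_vrho[OF ad P(1)[OF k] P(2)[OF k] d])
    show "shifted_degree n r (P k) = int (hdeg (fst (lexp lt (P k)))) + n (snd (lexp lt (P k)))"
      using shifted_degree_homogeneous[OF P(1)[OF k] P(2)[OF k] d]
        homogeneous_ofD[OF d vcoeff_lexp[OF P(1)[OF k] P(2)[OF k]]] by simp
    show "snd (lexp lt (P k)) \<in> {1..r}" by (rule lexp_range[OF P(1)[OF k] P(2)[OF k]])
  qed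
  have "((fst (lexp lt (P i)) + a, snd (lexp lt (P i))), (fst (lexp lt (P j)) + b, snd (lexp lt (P j)))) \<in> lt"
    using d w unfolding f(1,2)[OF i] f(1,2)[OF j]
    by (intro h_adaptedD[OF ad f(3)[OF i] f(3)[OF j]]) (simp_all add: hdeg_add weight_add)
  then show "((a, i), (b, j)) \<in> schreyer_order lt s P"
    unfolding schreyer_iff using i j by (simp add: expo_shift_def)
qed

text \<open>
  In a relation between the \<open>P\<^sub>k\<close> the top exponent cannot come from a single summand; the Schreyer
  leading position is the smallest one producing it, so another one lies further right.
\<close>

lemma syzygy_critical_pair:
  fixes P :: "nat \<Rightarrow> nat \<Rightarrow> ('n, 'k::field) hweyl"
  assumes P: "\<And>k. k \<in> {1..s} \<Longrightarrow> P k \<in> fmod r" "\<And>k. k \<in> {1..s} \<Longrightarrow> P k \<noteq> 0"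
    and Q: "Q \<in> Syz s P" "Q \<noteq> 0" and l: "lexp (schreyer_order lt s P) Q = (\<alpha>, \<mu>)"
  obtains k \<beta> where "\<mu> \<in> {1..s}" "k \<in> {1..s}" "\<mu> < k"
    "expo_shift (lexp lt (P k)) \<beta> = expo_shift (lexp lt (P \<mu>)) \<alpha>"
proof -
  interpret S: weyl_order s "schreyer_order lt s P" by (rule schreyer_weyl_order[OF P])
  have Qf: "Q \<in> fmod s" and Q0: "(\<Sum>k\<in>{1..s}. Q k \<odot> P k) = 0"
    using Q(1) by (simp_all add: Syz_def)
  have \<mu>: "\<mu> \<in> {1..s}" using S.lexp_range[OF Qf Q(2)] l by simp
  have nz: "hcoeff (Q \<mu>) \<alpha> \<noteq> 0" using S.vcoeff_lexp[OF Qf Q(2)] l by (simp add: vcoeff_def)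
  have max: "(\<gamma>, k) = (\<alpha>, \<mu>) \<or> ((\<gamma>, k), (\<alpha>, \<mu>)) \<in> schreyer_order lt s P"
    if "hcoeff (Q k) \<gamma> \<noteq> 0" for \<gamma> k
    using S.lexp_max[OF Qf Q(2), of "(\<gamma>, k)"] that l by (simp add: vcoeff_def)
  let ?M = "expo_shift (lexp lt (P \<mu>)) \<alpha>"
  have "vcoeff (Q \<mu> \<odot> P \<mu>) ?M = hcoeff (Q \<mu>) \<alpha> * lcoef lt (P \<mu>)"
  proof (rule vcoeff_lscale_lead[OF P(1)[OF \<mu>] P(2)[OF \<mu>] nz])
    fix \<delta> assume "hcoeff (Q \<mu>) \<delta> \<noteq> 0" "\<delta> \<noteq> \<alpha>"
    then show "(expo_shift (lexp lt (P \<mu>)) \<delta>, ?M) \<in> lt"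
      using max[of \<mu> \<delta>] by (auto simp: schreyer_iff)
  qed
  also have "\<dots> \<noteq> 0" using nz vcoeff_lexp[OF P(1)[OF \<mu>] P(2)[OF \<mu>]] by (simp add: lcoef_def)
  finally have c: "vcoeff (Q \<mu> \<odot> P \<mu>) ?M \<noteq> 0" .
  have "0 = vcoeff (\<Sum>k\<in>{1..s}. Q k \<odot> P k) ?M" by (simp only: Q0 vcoeff_simps)
  also have "\<dots> = vcoeff (Q \<mu> \<odot> P \<mu>) ?M + (\<Sum>k\<in>{1..s} - {\<mu>}. vcoeff (Q k \<odot> P k) ?M)"
    unfolding vcoeff_sum using \<mu> by (intro sum.remove) auto
  finally have "(\<Sum>k\<in>{1..s} - {\<mu>}. vcoeff (Q k \<odot> P k) ?M) \<noteq> 0" using c by auto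
  then obtain k where "k \<in> {1..s} - {\<mu>}" "vcoeff (Q k \<odot> P k) ?M \<noteq> 0"
    by (rule sum.not_neutral_contains_not_neutral)
  then have k: "k \<in> {1..s}" "k \<noteq> \<mu>" "vcoeff (Q k \<odot> P k) ?M \<noteq> 0" by auto
  obtain \<beta> where b: "hcoeff (Q k) \<beta> \<noteq> 0"
    "?M = expo_shift (lexp lt (P k)) \<beta> \<or> (?M, expo_shift (lexp lt (P k)) \<beta>) \<in> lt"
    by (rule vcoeff_lscale_nonzeroE[OF P(1)[OF k(1)] P(2)[OF k(1)] k(3)])
  have "((\<beta>, k), (\<alpha>, \<mu>)) \<in> schreyer_order lt s P" using max[OF b(1)] k(2) by auto
  \<comment> \<open>The Schreyer comparison puts the image of \<open>(\<beta>, k)\<close> at or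
    below \<open>?M\<close>, while \<open>b(2)\<close> puts it at or above. Equality leaves only the
    tie-break, which yields \<open>\<mu> < k\<close>.\<close>
  then have "expo_shift (lexp lt (P k)) \<beta> = ?M \<and> \<mu> < k"
    using b(2) lt_asym lt_irrefl unfolding schreyer_iff fst_conv snd_conv by metis
  then show thesis using that \<mu> k(1) by blast
qed

text \<open>The two monomials have the same image \<open>J\<close>, and the tie-break makes the one
  with the smaller index \<open>i\<close> larger. The remaining terms come from \<open>U\<close> and
  have images strictly below \<open>J\<close>.\<close>

lemma pair_syzygy_lead:
  fixes P :: "nat \<Rightarrow> nat \<Rightarrow> ('n, 'k::field) hweyl"
  assumes P: "\<And>k. k \<in> {1..s} \<Longrightarrow> P k \<in> fmod r" "\<And>k. k \<in> {1..s} \<Longrightarrow> P k \<noteq> 0"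
    and ij: "i \<in> {1..s}" "j \<in> {1..s}" "i < j"
    and Sji: "S j i = hmon \<gamma> c" "c \<noteq> 0" "expo_shift (lexp lt (P i)) \<gamma> = J"
    and Sij: "S i j = hmon \<delta> c'" "expo_shift (lexp lt (P j)) \<delta> = J"
    and U: "\<And>k. k \<in> {1..s} \<Longrightarrow> U i j k = 0 \<or> (lexp lt (U i j k \<odot> P k), J) \<in> lt"
  shows "vcoeff (pair_syzygy s S U i j) (\<gamma>, i) \<noteq> 0"
    and "lexp (schreyer_order lt s P) (pair_syzygy s S U i j) = (\<gamma>, i)"
    and "vcoeff (pair_syzygy s S U i j) (a, k) \<noteq> 0 \<Longrightarrow>
      (a, k) = (\<gamma>, i) \<or> (a, k) = (\<delta>, j) \<or> k \<in> {1..s} \<and> hcoeff (U i j k) a \<noteq> 0"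
proof -
  interpret S: weyl_order s "schreyer_order lt s P" by (rule schreyer_weyl_order[OF P])
  let ?V = "pair_syzygy s S U i j"
  \<comment> \<open>The hypothesis bounds only the lead of \<open>U i j k \<odot> P k\<close>; the
    other exponents of \<open>U i j k\<close> lie below the one that produces this lead.\<close>
  have Ulow: "(expo_shift (lexp lt (P k)) a, J) \<in> lt"
    if k: "k \<in> {1..s}" and nz: "hcoeff (U i j k) a \<noteq> 0" for a k
  proof -
    have U0: "U i j k \<noteq> 0" using nz by auto
    obtain g where g: "lexp lt (U i j k \<odot> P k) = expo_shift (lexp lt (P k)) g"
      and max: "\<And>a. hcoeff (U i j k) a \<noteq> 0 \<Longrightarrow> a \<noteq> g \<Longrightarrow>
        (expo_shift (lexp lt (P k)) a, expo_shift (lexp lt (P k)) g) \<in> lt"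
      by (rule lexp_lscale[OF P(1)[OF k] P(2)[OF k] U0]) (rule that; blast)
    have "(expo_shift (lexp lt (P k)) g, J) \<in> lt" using U[OF k] U0 g by simp
    then show ?thesis using max[OF nz] lt_trans by blast
  qed
  have supp: "(a, k) = (\<gamma>, i) \<or> (a, k) = (\<delta>, j) \<or> k \<in> {1..s} \<and> hcoeff (U i j k) a \<noteq> 0"
    if "vcoeff ?V (a, k) \<noteq> 0" for a k
    using that by (auto simp: vcoeff_def pair_syzygy_def Sji(1) Sij(1) split: if_splits)
  then show "vcoeff ?V (a, k) \<noteq> 0 \<Longrightarrow>
      (a, k) = (\<gamma>, i) \<or> (a, k) = (\<delta>, j) \<or> k \<in> {1..s} \<and> hcoeff (U i j k) a \<noteq> 0" .
  \<comment> \<open>Otherwise \<open>J\<close>, the image of \<open>(\<gamma>, i)\<close>, would be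
    smaller than itself. Hence \<open>U\<close> leaves the leading coefficient \<open>c\<close>
    untouched.\<close>
  have "hcoeff (U i j i) \<gamma> = 0" using Ulow[OF ij(1)] Sji(3) lt_irrefl by blast
  then show nz: "vcoeff ?V (\<gamma>, i) \<noteq> 0"
    using ij Sji(1,2) by (simp add: vcoeff_def pair_syzygy_def)
  show "lexp (schreyer_order lt s P) ?V = (\<gamma>, i)"
  proof (rule S.lexp_eqI[OF nz])
    fix e assume e: "vcoeff ?V e \<noteq> 0"
    obtain a k where ak: "e = (a, k)" by (cases e)
    from supp[OF e[unfolded ak]] consider "e = (\<gamma>, i)" | "e = (\<delta>, j)"
      | "k \<in> {1..s}" "hcoeff (U i j k) a \<noteq> 0" unfolding ak by blast
    then show "e = (\<gamma>, i) \<or> (e, (\<gamma>, i)) \<in> schreyer_order lt s P"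
    proof cases
      case 2
      then show ?thesis using ij Sji(3) Sij(2) by (simp add: schreyer_iff)
    next
      case 3
      then show ?thesis using Ulow[OF 3] ij Sji(3) by (simp add: schreyer_iff ak)
    qed simp
  qed
qed

end

section \<open>The syzygy module and its elements from critical pairs\<close>

lemma Syz_submodule: "left_submodule s (Syz s P)"
proof -
  have "(\<Sum>k\<in>{1..s}. (A + B) k \<odot> P k) = (\<Sum>k\<in>{1..s}. A k \<odot> P k) + (\<Sum>k\<in>{1..s}. B k \<odot> P k)" for A B
    unfolding sum.distrib[symmetric] by (intro sum.cong refl) (simp add: lscale_def fun_eq_iff distrib_right)
  moreover have "(\<Sum>k\<in>{1..s}. (a \<odot> A) k \<odot> P k) = a \<odot> (\<Sum>k\<in>{1..s}. A k \<odot> P k)" for a A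
  proof -
    have "(\<Sum>k\<in>K. (a \<odot> A) k \<odot> P k) = a \<odot> (\<Sum>k\<in>K. A k \<odot> P k)" for K
      by (induction K rule: infinite_finite_induct)
        (simp_all add: lscale_def fun_eq_iff distrib_left mult.assoc)
    then show ?thesis .
  qed
  moreover have "(\<Sum>k\<in>{1..s}. (0 :: nat \<Rightarrow> 'a) k \<odot> P k) = 0"
    by (rule sum.neutral) (simp add: lscale_def fun_eq_iff)
  ultimately show ?thesis
    unfolding left_submodule_def Syz_def by (simp add: fmod_closed lscale_simps subset_iff)
qed

lemma pair_syzygy_mem_Syz:
  assumes "i \<in> {1..s}" "j \<in> {1..s}" "i \<noteq> j"
    and "S j i \<odot> P i - S i j \<odot> P j = (\<Sum>k\<in>{1..s}. U i j k \<odot> P k)"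
  shows "pair_syzygy s S U i j \<in> Syz s P"
proof -
  let ?V = "pair_syzygy s S U i j"
  \<comment> \<open>Since \<open>i \<noteq> j\<close>, the nested conditional in
    \<open>pair_syzygy\<close> splits into two independent one-point sums.\<close>
  have t: "?V k \<odot> P k = (if k = i then S j i \<odot> P i else 0) + (if k = j then - (S i j \<odot> P j) else 0)
      - U i j k \<odot> P k" if "k \<in> {1..s}" for k
    using that assms(3) by (auto simp: pair_syzygy_def lscale_simps)
  have "(\<Sum>k\<in>{1..s}. ?V k \<odot> P k) = (\<Sum>k\<in>{1..s}. if k = i then S j i \<odot> P i else 0)
      + (\<Sum>k\<in>{1..s}. if k = j then - (S i j \<odot> P j) else 0) - (\<Sum>k\<in>{1..s}. U i j k \<odot> P k)"
    unfolding sum.distrib[symmetric] sum_subtractf[symmetric] using t by (rule sum.cong[OF refl])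
  also have "\<dots> = S j i \<odot> P i + - (S i j \<odot> P j) - (\<Sum>k\<in>{1..s}. U i j k \<odot> P k)"
    unfolding sum.delta[OF finite_atLeastAtMost] using assms(1,2) by (simp only: if_True)
  also have "\<dots> = 0" unfolding assms(4)[symmetric] by simp
  finally show ?thesis by (simp add: Syz_def fmod_def pair_syzygy_def)
qed

theorem theorem9p10:
  fixes w :: "'n::finite + 'n \<Rightarrow> int"
    and r s :: nat
    and m n m' n' :: "nat \<Rightarrow> int"
    and prec :: "('n expo \<times> nat) rel"
    and lt lt' :: "('n hexpo \<times> nat) rel"
    and N F :: "(nat \<Rightarrow> ('n, 'k::field_char_0) weyl) set"
    and P :: "nat \<Rightarrow> nat \<Rightarrow> ('n, 'k) hweyl"
    and \<Lambda> :: "(nat \<times> nat) set"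
    and S :: "nat \<Rightarrow> nat \<Rightarrow> ('n, 'k) hweyl"
    and U :: "nat \<Rightarrow> nat \<Rightarrow> nat \<Rightarrow> ('n, 'k) hweyl"
    and V :: "nat \<Rightarrow> nat \<Rightarrow> nat \<Rightarrow> ('n, 'k) hweyl"
  assumes w_nonzero: "w \<noteq> 0"
    and w_weight: "\<And>i. w (Inl i) + w (Inr i) \<ge> 0"
    and prec_order: "monomial_order r prec"
    and prec_adapted: "adapted w m r prec"
    and lt_def: "lt = h_order n r prec"
    and N_submodule: "left_submodule r N"
    and F_generates: "finite F" "F \<subseteq> N" "N = left_submodule r hull F"
    and P_groebner: "groebner_basis r lt
      (left_submodule r hull (h_homogenization n r ` F)) (P ` {1..s})"
    and P_nonzero: "\<And>i. i \<in> {1..s} \<Longrightarrow> P i \<noteq> 0"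
    and P_homogeneous: "\<And>i. i \<in> {1..s} \<Longrightarrow> h_homogeneous n (P i)"
    and \<Lambda>_def: "\<Lambda> = critical_pairs lt s P"
    and S_monomial: "\<And>i j. (i, j) \<in> \<Lambda> \<Longrightarrow> is_hmonomial (S j i) \<and> is_hmonomial (S i j)"
    and S_lexp: "\<And>i j. (i, j) \<in> \<Lambda> \<Longrightarrow>
      lexp lt (S j i \<odot> P i) = lexp lt (S i j \<odot> P j) \<and>
      lexp lt (S i j \<odot> P j) = expo_join (lexp lt (P i)) (lexp lt (P j))"
    and S_lcoef: "\<And>i j. (i, j) \<in> \<Lambda> \<Longrightarrow>
      lcoef lt (S j i \<odot> P i) = lcoef lt (S i j \<odot> P j)"
    and U_homogeneous: "\<And>i j k. (i, j) \<in> \<Lambda> \<Longrightarrow> k \<in> {1..s} \<Longrightarrow> homogeneous (U i j k)"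
    and UP_homogeneous: "\<And>i j k. (i, j) \<in> \<Lambda> \<Longrightarrow> k \<in> {1..s} \<Longrightarrow>
      U i j k \<odot> P k = 0 \<or>
      h_homogeneous n (U i j k \<odot> P k) \<and>
      shifted_degree n r (U i j k \<odot> P k) = shifted_degree n r (S j i \<odot> P i)"
    and S_pair: "\<And>i j. (i, j) \<in> \<Lambda> \<Longrightarrow>
      S j i \<odot> P i - S i j \<odot> P j = (\<Sum>k\<in>{1..s}. U i j k \<odot> P k)"
    and U_lexp: "\<And>i j k. (i, j) \<in> \<Lambda> \<Longrightarrow> k \<in> {1..s} \<Longrightarrow>
      U i j k = 0 \<or>
      (lexp lt (U i j k \<odot> P k), expo_join (lexp lt (P i)) (lexp lt (P j))) \<in> lt"
    and lt'_def: "lt' = schreyer_order lt s P"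
    and m'_def: "m' = (\<lambda>k. filt_ord w m r (vrho (P k)))"
    and n'_def: "n' = (\<lambda>k. shifted_degree n r (P k))"
    and V_def: "V = pair_syzygy s S U"
  shows "strict_total_order_on (UNIV \<times> {1..s}) lt' \<and> wf lt' \<and> h_adapted w m' n' s lt' \<and>
    (\<forall>(i, j)\<in>\<Lambda>. h_homogeneous n' (V i j)) \<and>
    groebner_basis s lt' (Syz s P) {V i j | i j. (i, j) \<in> \<Lambda>} \<and>
    (\<forall>\<nu>. \<forall>R \<in> Syz s (\<lambda>k. vrho (P k)) \<inter> module_filt w m' s \<nu>.
      \<exists>Q. R = (\<Sum>(i, j)\<in>\<Lambda>. Q i j \<odot> vrho (V i j)) \<and>
        (\<forall>(i, j)\<in>\<Lambda>. Q i j \<odot> vrho (V i j) \<in> module_filt w m' s \<nu>))"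
proof -
  interpret L: weyl_order r lt
    unfolding lt_def by (rule h_order_weyl_order[OF prec_order prec_adapted])
  have wf: "wf lt" using wf_h_order L.weyl_order_axioms unfolding lt_def by blast
  have ad: "h_adapted w m n r lt"
    unfolding lt_def by (rule h_order_adapted[OF prec_order prec_adapted])
  have Pf: "P k \<in> fmod r" if "k \<in> {1..s}" for k
    using P_groebner that unfolding groebner_basis_def left_submodule_def by blast
  interpret S: weyl_order s lt'
    unfolding lt'_def by (rule L.schreyer_weyl_order[OF Pf P_nonzero])
  have wf': "wf lt'" unfolding lt'_def by (rule L.wf_schreyer_order[OF wf])
  have ad': "h_adapted w m' n' s lt'"
    unfolding lt'_def m'_def n'_def
    by (rule L.schreyer_adapted[OF Pf P_nonzero ad P_homogeneous])
  have Phom: "homogeneous_of n (n' k) (P k)" if k: "k \<in> {1..s}" for k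
  proof -
    obtain d where d: "homogeneous_of n d (P k)" using P_homogeneous[OF k] h_homogeneous_iff by blast
    with shifted_degree_homogeneous[OF Pf[OF k] P_nonzero[OF k] d] show ?thesis by (simp add: n'_def)
  qed
  have n'_lexp: "n' k = int (hdeg (fst (lexp lt (P k)))) + n (snd (lexp lt (P k)))"
    if k: "k \<in> {1..s}" for k
    using homogeneous_ofD[OF Phom[OF k] L.vcoeff_lexp[OF Pf[OF k] P_nonzero[OF k]]] by simp
  have \<Lambda>: "i \<in> {1..s}" "j \<in> {1..s}" "i < j" if "(i, j) \<in> \<Lambda>" for i j
    using that by (auto simp: \<Lambda>_def critical_pairs_def)
  have "\<Lambda> \<subseteq> {1..s} \<times> {1..s}" using \<Lambda> by auto
  then have fin\<Lambda>: "finite \<Lambda>" by (rule finite_subset) simp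
  have lead: "\<exists>\<gamma>. expo_shift (lexp lt (P i)) \<gamma> = expo_join (lexp lt (P i)) (lexp lt (P j)) \<and>
      V i j \<noteq> 0 \<and> lexp lt' (V i j) = (\<gamma>, i) \<and> V i j \<in> Syz s P \<and> h_homogeneous n' (V i j)"
    if ij: "(i, j) \<in> \<Lambda>" for i j
  proof -
    let ?J = "expo_join (lexp lt (P i)) (lexp lt (P j))"
    note k = \<Lambda>[OF ij]
    obtain \<gamma> c \<delta> c' where c: "S j i = hmon \<gamma> c" "c \<noteq> 0" "S i j = hmon \<delta> c'" "c' \<noteq> 0"
      using S_monomial[OF ij] unfolding is_hmonomial_def by blast
    have J: "expo_shift (lexp lt (P i)) \<gamma> = ?J" "expo_shift (lexp lt (P j)) \<delta> = ?J"
      using S_lexp[OF ij] L.lexp_hmon_lscale(1)[OF Pf[OF k(1)] P_nonzero[OF k(1)] c(2), of \<gamma>]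
        L.lexp_hmon_lscale(1)[OF Pf[OF k(2)] P_nonzero[OF k(2)] c(4), of \<delta>]
      unfolding c(1,3) by simp_all
    note V = L.pair_syzygy_lead[where P = P and S = S and U = U and s = s and i = i and j = j, OF Pf P_nonzero k c(1,2) J(1) c(3) J(2) U_lexp[OF ij],
        folded V_def lt'_def]
    have "V i j \<in> Syz s P"
      unfolding V_def using k by (intro pair_syzygy_mem_Syz S_pair[OF ij]) auto
    moreover have "V i j \<noteq> 0" using V(1) by auto
    \<comment> \<open>The common degree is that of \<open>S j i \<odot> P i\<close>. The term at
      \<open>j\<close> shares it because both leads are shifted to the join; the terms of
      \<open>U\<close> share it by the degree hypothesis on the
      \<open>U i j k \<odot> P k\<close>.\<close>
    moreover have "homogeneous_of n' (int (hdeg \<gamma>) + n' i) (V i j)"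
      unfolding homogeneous_of_def
    proof (intro allI impI)
      fix e assume e: "vcoeff (V i j) e \<noteq> 0"
      obtain a l where al: "e = (a, l)" by (cases e)
      from V(3)[OF _ _ _ e[unfolded al]] consider "e = (\<gamma>, i)" | "e = (\<delta>, j)"
        | "l \<in> {1..s}" "hcoeff (U i j l) a \<noteq> 0" unfolding al by blast
      then show "int (hdeg (fst e)) + n' (snd e) = int (hdeg \<gamma>) + n' i"
      proof cases
        case 2
        have "fst (lexp lt (P i)) + \<gamma> = fst (lexp lt (P j)) + \<delta>"
          "snd (lexp lt (P i)) = snd (lexp lt (P j))"
          using J by (metis fst_expo_shift, metis snd_expo_shift)
        moreover from this(1) have "hdeg (fst (lexp lt (P i))) + hdeg \<gamma> = hdeg (fst (lexp lt (P j))) + hdeg \<delta>"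
          by (metis hdeg_add)
        ultimately show ?thesis using 2 n'_lexp[OF k(1)] n'_lexp[OF k(2)] by simp
      next
        case 3
        then have U0: "U i j l \<noteq> 0" by auto
        obtain u where u: "\<And>a. hcoeff (U i j l) a \<noteq> 0 \<Longrightarrow> hdeg a = u"
          using U_homogeneous[OF ij 3(1)] unfolding homogeneous_def by blast
        \<comment> \<open>This rules out the zero alternative in \<open>UP_homogeneous\<close>, so
          the degrees may be compared.\<close>
        have UP0: "U i j l \<odot> P l \<noteq> 0"
          by (rule L.lexp_lscale[OF Pf[OF 3(1)] P_nonzero[OF 3(1)] U0])
        have "homogeneous_of n (int u + n' l) (U i j l \<odot> P l)"
          by (rule homogeneous_of_lscale[OF Phom[OF 3(1)]]) (simp add: u)
        then have 1: "shifted_degree n r (U i j l \<odot> P l) = int u + n' l"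
          by (rule shifted_degree_homogeneous[OF fmod_closed(4)[OF Pf[OF 3(1)]] UP0])
        have "homogeneous_of n (int (hdeg \<gamma>) + n' i) (S j i \<odot> P i)"
          by (rule homogeneous_of_lscale[OF Phom[OF k(1)]]) (simp add: c(1) split: if_splits)
        moreover have "S j i \<odot> P i \<noteq> 0"
          unfolding c(1) by (rule L.lexp_hmon_lscale(3)[OF Pf[OF k(1)] P_nonzero[OF k(1)] c(2)])
        ultimately have "shifted_degree n r (S j i \<odot> P i) = int (hdeg \<gamma>) + n' i"
          using shifted_degree_homogeneous[OF fmod_closed(4)[OF Pf[OF k(1)]]] by blast
        then show ?thesis using UP_homogeneous[OF ij 3(1)] UP0 1 u[OF 3(2)] by (simp add: al)
      qed simp
    qed
    ultimately show ?thesis using J(1) V(2) h_homogeneous_iff by blast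
  qed
  have Vset: "{V i j | i j. (i, j) \<in> \<Lambda>} = (\<lambda>(i, j). V i j) ` \<Lambda>" by auto
  have gb: "groebner_basis s lt' (Syz s P) ((\<lambda>(i, j). V i j) ` \<Lambda>)"
    unfolding groebner_basis_def
  proof (intro conjI ballI impI)
    show "left_submodule s (Syz s P)" by (rule Syz_submodule)
    show "finite ((\<lambda>(i, j). V i j) ` \<Lambda>)" using fin\<Lambda> by simp
    show "(\<lambda>(i, j). V i j) ` \<Lambda> \<subseteq> Syz s P" using lead by fast
    fix Q assume Q: "Q \<in> Syz s P" "Q \<noteq> 0"
    obtain \<alpha> \<mu> where l: "lexp lt' Q = (\<alpha>, \<mu>)" by (cases "lexp lt' Q")
    obtain k \<beta> where k: "\<mu> \<in> {1..s}" "k \<in> {1..s}" "\<mu> < k"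
      "expo_shift (lexp lt (P k)) \<beta> = expo_shift (lexp lt (P \<mu>)) \<alpha>"
      by (rule L.syzygy_critical_pair[OF Pf P_nonzero Q l[unfolded lt'_def]])
    have "lp lt (P \<mu>) = lp lt (P k)" unfolding lp_def using k(4) by (metis snd_expo_shift)
    then have \<mu>k: "(\<mu>, k) \<in> \<Lambda>" using k by (simp add: \<Lambda>_def critical_pairs_def)
    obtain \<gamma> where g: "expo_shift (lexp lt (P \<mu>)) \<gamma> = expo_join (lexp lt (P \<mu>)) (lexp lt (P k))"
      "V \<mu> k \<noteq> 0" "lexp lt' (V \<mu> k) = (\<gamma>, \<mu>)" using lead[OF \<mu>k] by blast
    obtain \<theta> where "expo_shift (lexp lt (P \<mu>)) \<alpha> = expo_shift (expo_join (lexp lt (P \<mu>)) (lexp lt (P k))) \<theta>"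
      by (rule expo_join_dvd[OF k(4)[symmetric]])
    \<comment> \<open>The join is itself the lead of \<open>P \<mu>\<close> shifted by \<gamma>, so
      this lead can be cancelled from both sides.\<close>
    then have "\<alpha> = \<gamma> + \<theta>" unfolding g(1)[symmetric] expo_shift_shift by simp
    then have "lexp lt' Q = expo_shift (lexp lt' (V \<mu> k)) \<theta>" by (simp add: l g(3))
    moreover have "V \<mu> k \<in> (\<lambda>(i, j). V i j) ` \<Lambda> - {0}" using \<mu>k g(2) by force
    ultimately show "lexp lt' Q \<in> (\<Union>X\<in>(\<lambda>(i, j). V i j) ` \<Lambda> - {0}. range (expo_shift (lexp lt' X)))"
      by blast
  qed
  have part2: "\<exists>Q. R = (\<Sum>(i, j)\<in>\<Lambda>. Q i j \<odot> vrho (V i j)) \<and>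
      (\<forall>(i, j)\<in>\<Lambda>. Q i j \<odot> vrho (V i j) \<in> module_filt w m' s \<nu>)"
    if R: "R \<in> Syz s (\<lambda>k. vrho (P k))" "R \<in> module_filt w m' s \<nu>" for R \<nu>
  proof -
    have Rf: "R \<in> fmod s" and R0: "(\<Sum>k\<in>{1..s}. R k \<odot> vrho (P k)) = 0"
      using R(1) by (simp_all add: Syz_def)
    \<comment> \<open>Homogenizing with the shift \<open>n'\<close>, the degrees of the
      \<open>P\<^sub>k\<close>, gives all products \<open>X k \<odot> P k\<close> the same degree
      \<open>d\<close> with respect to \<open>n\<close>. Their sum is then homogeneous, and vanishes
      as soon as its image at \<open>h = 1\<close> does.\<close>
    obtain d X where X: "X \<in> fmod s" "homogeneous_of n' d X" "vrho X = R"
      "\<And>i l \<alpha>. hcoeff (X i) (l, \<alpha>) \<noteq> 0 \<Longrightarrow> coeff (R i) \<alpha> \<noteq> 0"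
      by (rule homogenization_exists[OF Rf, where n = n']) (rule that; blast)
    have "homogeneous_of n d (\<Sum>k\<in>{1..s}. X k \<odot> P k)"
    proof (rule homogeneous_of_sum)
      fix k assume k: "k \<in> {1..s}"
      show "homogeneous_of n d (X k \<odot> P k)"
        by (rule homogeneous_of_lscale[OF Phom[OF k]])
          (use homogeneous_ofD[OF X(2), of "(_, k)"] in \<open>simp add: vcoeff_def\<close>)
    qed
    moreover have "vrho (\<Sum>k\<in>{1..s}. X k \<odot> P k) = (\<Sum>k\<in>{1..s}. R k \<odot> vrho (P k))"
      unfolding vrho_sum vrho_simps X(3)[symmetric] vrho_def[of X] ..
    ultimately have "(\<Sum>k\<in>{1..s}. X k \<odot> P k) = 0"
      using R0 by (intro vrho_homogeneous_eq_0) auto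
    then have XS: "X \<in> Syz s P" using X(1) by (simp add: Syz_def)
    have Xw: "weight w (snd (fst e)) + m' (snd e) \<le> \<nu>" if "vcoeff X e \<noteq> 0" for e
    proof -
      have e: "snd e \<in> {1..s}" using vcoeff_fmod[OF X(1) that] by (simp add: mem_Times_iff)
      have "coeff (R (snd e)) (snd (fst e)) \<noteq> 0"
        using that X(4)[of "snd e" "fst (fst e)" "snd (fst e)"] by (simp add: vcoeff_def)
      moreover have "R (snd e) \<in> weyl_filt w (\<nu> - m' (snd e))"
        using R(2) e unfolding module_filt_def by blast
      ultimately have "weight w (snd (fst e)) \<le> \<nu> - m' (snd e)" unfolding weyl_filt_def by blast
      then show ?thesis by simp
    qed
    have "h_homogeneous n' ((\<lambda>(i, j). V i j) p)" if "p \<in> \<Lambda>" for p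
      using lead that by (cases p) auto
    from S.groebner_division[OF wf' ad' fin\<Lambda> gb this XS X(2) Xw]
    obtain Q where Q: "vrho X = (\<Sum>p\<in>\<Lambda>. Q p \<odot> vrho (case p of (i, j) \<Rightarrow> V i j))"
      "\<forall>p\<in>\<Lambda>. Q p \<odot> vrho (case p of (i, j) \<Rightarrow> V i j) \<in> module_filt w m' s \<nu>" by blast
    show ?thesis
    proof (intro exI[of _ "\<lambda>i j. Q (i, j)"] conjI)
      show "R = (\<Sum>(i, j)\<in>\<Lambda>. Q (i, j) \<odot> vrho (V i j))"
        unfolding X(3)[symmetric] Q(1) by (intro sum.cong) auto
      show "\<forall>(i, j)\<in>\<Lambda>. Q (i, j) \<odot> vrho (V i j) \<in> module_filt w m' s \<nu>" using Q(2) by auto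
    qed
  qed
  show ?thesis
    unfolding Vset using S.order wf' ad' lead gb part2 by blast
qed

end
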